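(* Let $\mathcal X\subset\mathbb R^n$ be a connected manifold with generalized boundary (MGB). Let $g$ and $h_1,\dots,h_k$ be real-valued $C^\infty$ functions of $(x,y)\in\mathcal X\times\mathbb R^m$ and let $\mathcal Y(x)=\{y\in\mathbb R^m: h_i(x,y)\le 0,\ i=1,\dots,k\}$. Assume that $\mathcal Y(x)\ne\emptyset$ for every $x\in\mathcal X$, that the sets $\mathcal Y(x)$, $x\in\mathcal X$, are uniformly bounded, that LICQ, SCSC and uniform SOSC hold for the lower-level problem $\min_{y\in\mathcal Y(x)}g(x,y)$ at every $x\in\mathcal X$, and that for every $x\in\mathcal X$ the lower-level problem has finitely many local minimizers. Then for every $\mathcal J\subseteq\{1,\dots,k\}$ and any $x_1,x_2\in\mathcal X$, $$\#\{\text{local minimizers of the lower-level problem at }x_1\text{ in }\mathcal S_{\mathcal J}(x_1)\}=\#\{\text{local minimizers of the lower-level problem at }x_2\text{ in }\mathcal S_{\mathcal J}(x_2)\}.$$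
   Context: Active set: $\mathcal J(x,y)=\{i:h_i(x,y)=0\}$. Strata: $\mathcal S_{\mathcal J}(x)=\{y\in\mathcal Y(x):\mathcal J(x,y)=\mathcal J\}$. KKT pair at $x$: $(y,\lambda)\in\mathbb R^m\times\mathbb R^k$ with $\nabla_y g(x,y)+\sum_i\lambda_i\nabla_y h_i(x,y)=0$, $h_i(x,y)\le 0$, $\lambda_i\ge 0$, $\lambda_i h_i(x,y)=0$ for all $i$. Lagrangian: $\mathcal L(x,y,\lambda)=g(x,y)+\sum_{i=1}^k\lambda_i h_i(x,y)$. LICQ holds at $x$ if for every $y\in\mathcal Y(x)$ the vectors $\{\nabla_y h_i(x,y): i\in\mathcal J(x,y)\}$ are linearly independent. SCSC holds at $x$ if for every KKT pair $(y^\ast,\lambda^\ast)$ at $x$ and every $i$, either $h_i(x,y^\ast)<0$ and $\lambda^\ast_i=0$, or $h_i(x,y^\ast)=0$ and $\lambda^\ast_i>0$. Critical cone at a KKT pair $(y^\ast,\lambda^\ast)$: $\mathcal C(x,y^\ast)=\{d\in\mathbb R^m:\nabla_y h_i(x,y^\ast)^\top d=0\text{ if }\lambda^\ast_i>0,\ \nabla_y h_i(x,y^\ast)^\top d\le 0\text{ if }\lambda^\ast_i=0,\ \forall i\in\mathcal J(x,y^\ast)\}$. Uniform SOSC: there is $\sigma>0$, independent of $x$, such that for every $x\in\mathcal X$ and every local minimizer $y^\ast$ at $x$ with associated KKT multiplier $\lambda^\ast$, $d^\top\nabla^2_{yy}\mathcal L(x,y^\ast,\lambda^\ast)d\ge\sigma\|d\|^2$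 for all $d\in\mathcal C(x,y^\ast)$. MGB: $X\subset\mathbb R^N$ is a manifold with generalized boundary if for each $p_0\in X$ there is a local $C^\infty$ coordinate system $\psi:U\to V$ of $\mathbb R^N$ with $\psi(p_0)=0$ and integers $q,p\ge0$ such that $\psi(U\cap X)=\{v\in V: v_1=\dots=v_q=0,\ v_{q+1}\ge0,\dots,v_{q+p}\ge0\}$. Uniformly bounded: there is $R>0$ with $\mathcal Y(x)\subset\{y:\|y\|\le R\}$ for all $x\in\mathcal X$. *)

theory Defs
  imports "HOL-Analysis.Analysis"
begin

section \<open>Smooth functions\<close>

text \<open>Only meaningful for open \<open>S\<close>. The \<open>(n+1)\<close>-st level asks that every directional
  derivative be of class \<open>C\<^sup>n\<close>; in finite dimension this is the usual class \<open>C\<^sup>n\<^sup>+\<^sup>1\<close>.\<close>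

primrec Ck_on :: "nat \<Rightarrow> 'a::real_normed_vector set \<Rightarrow> ('a \<Rightarrow> 'b::real_normed_vector) \<Rightarrow> bool" where
  "Ck_on 0 S f \<longleftrightarrow> continuous_on S f"
| "Ck_on (Suc n) S f \<longleftrightarrow>
     (\<forall>x\<in>S. f differentiable (at x)) \<and> (\<forall>v. Ck_on n S (\<lambda>x. frechet_derivative f (at x) v))"

definition smooth_on_open :: "'a::real_normed_vector set \<Rightarrow> ('a \<Rightarrow> 'b::real_normed_vector) \<Rightarrow> bool" where
  "smooth_on_open S f \<longleftrightarrow> open S \<and> (\<forall>n. Ck_on n S f)"

text \<open>Smoothness on an arbitrary subset of Euclidean space, in the usual sense of admitting
  a smooth extension to an open neighbourhood of each point. Values of \<open>f\<close> outside \<open>S\<close> are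
  irrelevant.\<close>

definition smooth_on :: "'a::real_normed_vector set \<Rightarrow> ('a \<Rightarrow> 'b::real_normed_vector) \<Rightarrow> bool" where
  "smooth_on S f \<longleftrightarrow>
     (\<forall>p\<in>S. \<exists>W F. p \<in> W \<and> smooth_on_open W F \<and> (\<forall>z\<in>W \<inter> S. F z = f z))"

definition grad :: "('a::real_inner \<Rightarrow> real) \<Rightarrow> 'a \<Rightarrow> 'a" where
  "grad f y = (THE D. GDERIV f y :> D)"

definition hessian :: "(real^'m \<Rightarrow> real) \<Rightarrow> real^'m \<Rightarrow> real^'m^'m" where
  "hessian f y = matrix (frechet_derivative (grad f) (at y))"

section \<open>Manifolds with generalized boundary\<close>

definition local_coordinates :: "(real^'n) set \<Rightarrow> (real^'n) set \<Rightarrow> (real^'n \<Rightarrow> real^'n) \<Rightarrow> bool" where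
  "local_coordinates U V \<psi> \<longleftrightarrow>
     (\<exists>\<phi>. homeomorphism U V \<psi> \<phi> \<and> smooth_on_open U \<psi> \<and> smooth_on_open V \<phi>)"

text \<open>The coordinates of \<open>real^'n\<close> are indexed by the unordered type \<open>'n\<close>, so the numbering
  \<open>v\<^sub>1, \<dots>, v\<^sub>N\<close> is supplied by an enumeration \<open>e\<close> of \<open>'n\<close>. Both \<open>q\<close> and \<open>p\<close> may depend on
  the point \<open>p0\<close>.\<close>

definition MGB :: "(real^'n) set \<Rightarrow> bool" where
  "MGB X \<longleftrightarrow>
     (\<forall>p0\<in>X. \<exists>U V \<psi> (e :: nat \<Rightarrow> 'n) q p.
        p0 \<in> U \<and> local_coordinates U V \<psi> \<and> \<psi> p0 = 0 \<and>
        bij_betw e {1..CARD('n)} UNIV \<and> q + p \<le> CARD('n) \<and>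
        \<psi> ` (U \<inter> X) =
          {v\<in>V. (\<forall>j\<in>{1..q}. v $ e j = 0) \<and> (\<forall>j\<in>{q+1..q+p}. v $ e j \<ge> 0)})"

section \<open>The parametric lower-level problem\<close>

text \<open>The constraints are \<open>h 1, \<dots>, h k\<close>, and a multiplier is a function \<open>nat \<Rightarrow> real\<close>;
  indices outside \<open>{1..k}\<close> are never consulted.\<close>

definition feasible :: "nat \<Rightarrow> (nat \<Rightarrow> 'a \<Rightarrow> 'b \<Rightarrow> real) \<Rightarrow> 'a \<Rightarrow> 'b set" where
  "feasible k h x = {y. \<forall>i\<in>{1..k}. h i x y \<le> 0}"

definition active_set :: "nat \<Rightarrow> (nat \<Rightarrow> 'a \<Rightarrow> 'b \<Rightarrow> real) \<Rightarrow> 'a \<Rightarrow> 'b \<Rightarrow> nat set" where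
  "active_set k h x y = {i\<in>{1..k}. h i x y = 0}"

definition stratum :: "nat \<Rightarrow> (nat \<Rightarrow> 'a \<Rightarrow> 'b \<Rightarrow> real) \<Rightarrow> nat set \<Rightarrow> 'a \<Rightarrow> 'b set" where
  "stratum k h J x = {y \<in> feasible k h x. active_set k h x y = J}"

definition local_minimizer ::
  "('a \<Rightarrow> 'b::metric_space \<Rightarrow> real) \<Rightarrow> nat \<Rightarrow> (nat \<Rightarrow> 'a \<Rightarrow> 'b \<Rightarrow> real) \<Rightarrow> 'a \<Rightarrow> 'b \<Rightarrow> bool" where
  "local_minimizer g k h x y \<longleftrightarrow>
     y \<in> feasible k h x \<and> (\<exists>\<epsilon>>0. \<forall>z \<in> feasible k h x \<inter> ball y \<epsilon>. g x y \<le> g x z)"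

definition KKT_pair ::
  "('a \<Rightarrow> 'b::real_inner \<Rightarrow> real) \<Rightarrow> nat \<Rightarrow> (nat \<Rightarrow> 'a \<Rightarrow> 'b \<Rightarrow> real) \<Rightarrow> 'a \<Rightarrow> 'b \<Rightarrow> (nat \<Rightarrow> real) \<Rightarrow> bool" where
  "KKT_pair g k h x y l \<longleftrightarrow>
     grad (g x) y + (\<Sum>i=1..k. l i *\<^sub>R grad (h i x) y) = 0 \<and>
     (\<forall>i\<in>{1..k}. h i x y \<le> 0 \<and> l i \<ge> 0 \<and> l i * h i x y = 0)"

definition lagrangian ::
  "('a \<Rightarrow> 'b \<Rightarrow> real) \<Rightarrow> nat \<Rightarrow> (nat \<Rightarrow> 'a \<Rightarrow> 'b \<Rightarrow> real) \<Rightarrow> 'a \<Rightarrow> (nat \<Rightarrow> real) \<Rightarrow> 'b \<Rightarrow> real" where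
  "lagrangian g k h x l y = g x y + (\<Sum>i=1..k. l i * h i x y)"

text \<open>Linear independence is that of the indexed family, hence the injectivity clause.\<close>

definition LICQ :: "nat \<Rightarrow> (nat \<Rightarrow> 'a \<Rightarrow> 'b::real_inner \<Rightarrow> real) \<Rightarrow> 'a \<Rightarrow> bool" where
  "LICQ k h x \<longleftrightarrow>
     (\<forall>y \<in> feasible k h x.
        inj_on (\<lambda>i. grad (h i x) y) (active_set k h x y) \<and>
        independent ((\<lambda>i. grad (h i x) y) ` active_set k h x y))"

definition SCSC ::
  "('a \<Rightarrow> 'b::real_inner \<Rightarrow> real) \<Rightarrow> nat \<Rightarrow> (nat \<Rightarrow> 'a \<Rightarrow> 'b \<Rightarrow> real) \<Rightarrow> 'a \<Rightarrow> bool" where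
  "SCSC g k h x \<longleftrightarrow>
     (\<forall>y l. KKT_pair g k h x y l \<longrightarrow>
        (\<forall>i\<in>{1..k}. (h i x y < 0 \<and> l i = 0) \<or> (h i x y = 0 \<and> l i > 0)))"

definition critical_cone ::
  "nat \<Rightarrow> (nat \<Rightarrow> 'a \<Rightarrow> 'b::real_inner \<Rightarrow> real) \<Rightarrow> 'a \<Rightarrow> 'b \<Rightarrow> (nat \<Rightarrow> real) \<Rightarrow> 'b set" where
  "critical_cone k h x y l =
     {d. \<forall>i \<in> active_set k h x y.
           (l i > 0 \<longrightarrow> grad (h i x) y \<bullet> d = 0) \<and> (l i = 0 \<longrightarrow> grad (h i x) y \<bullet> d \<le> 0)}"

definition uniform_SOSC ::
  "'a set \<Rightarrow> ('a \<Rightarrow> real^'m \<Rightarrow> real) \<Rightarrow> nat \<Rightarrow> (nat \<Rightarrow> 'a \<Rightarrow> real^'m \<Rightarrow> real) \<Rightarrow> bool" where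
  "uniform_SOSC X g k h \<longleftrightarrow>
     (\<exists>\<sigma>>0. \<forall>x\<in>X. \<forall>y l. local_minimizer g k h x y \<and> KKT_pair g k h x y l \<longrightarrow>
        (\<forall>d \<in> critical_cone k h x y l.
           d \<bullet> (hessian (lagrangian g k h x l) y *v d) \<ge> \<sigma> * (norm d)\<^sup>2))"

definition uniformly_bounded :: "'a set \<Rightarrow> ('a \<Rightarrow> 'b::real_normed_vector set) \<Rightarrow> bool" where
  "uniformly_bounded X Y \<longleftrightarrow> (\<exists>R>0. \<forall>x\<in>X. Y x \<subseteq> {y. norm y \<le> R})"

end

(*
  Throughout, x is a mere parameter, and all limits only use that g, h and their first two
  y-derivatives are jointly continuous in (x, y). As X is connected, it suffices that the number
  of minimizers in a stratum is locally constant on X.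

  Let minimizers y_n at x_n converge to y as x_n tends to x. By LICQ their multipliers converge to
  a multiplier of y, and strict complementarity at x forces the active sets to agree eventually.
  The uniform constant in SOSC carries positivity of the Hessian of the Lagrangian on the tangent
  space over to y, so that y is a minimizer too: minimizers near x stay close to those at x. The
  same positivity, applied to difference quotients, shows that two minimizers cannot merge in the
  limit. Conversely, a minimizer y at x is strict, and minimizing over a small ball about y (which
  by LICQ contains feasible points at nearby parameters) produces a nearby minimizer.
*)
theory Submission
  imports Defs
begin

section \<open>Linear independence under perturbation\<close>

text \<open>SOSC is assumed at local minimizers only. This circle shapes the proof: positivity at y
  must be inherited from the approximating points, where a constant varying with x could degenerate
  to 0. SCSC is assumed at every KKT pair, so it applies to y as soon as y has a multiplier.

  All exclusion arguments rest on one sequential statement, \<open>KKT_local_uniqueness\<close>,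
  which is used three times: for strictness of a minimizer, for minimality of a limit point, and for
  separation of minimizers. Convergent subsequences come from the uniform bound on the feasible
  sets.

  Derivatives are taken in y alone. X may have empty interior, but \<open>X \<times> UNIV\<close>
  contains the whole slice over each x in X, so y-derivatives there are intrinsic and can be
  computed from any local smooth extension.\<close>

lemma dual_family:
  fixes v :: "'i \<Rightarrow> 'b::euclidean_space"
  assumes "inj_on v J" "independent (v ` J)"
  obtains u where "\<And>i j. i \<in> J \<Longrightarrow> j \<in> J \<Longrightarrow> u i \<bullet> v j = (if i = j then 1 else 0)"
proof -
  have "\<exists>w. \<forall>j\<in>J. w \<bullet> v j = (if i = j then 1 else 0)" if "i \<in> J" for i
  proof -
    obtain f :: "'b \<Rightarrow> real" where f: "linear f" "\<forall>x\<in>v ` J. f x = (if x = v i then 1 else 0)"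
      using linear_independent_extend[OF assms(2), of "\<lambda>x. if x = v i then 1 else 0"] by auto
    \<comment> \<open>\<open>adjoint f 1\<close> is the Riesz representative of the functional
      \<open>f\<close>.\<close>
    have "adjoint f 1 \<bullet> v j = (if i = j then 1 else 0)" if "j \<in> J" for j
    proof -
      have "adjoint f 1 \<bullet> v j = f (v j)"
        using adjoint_works[OF f(1), of "v j" 1] by (simp add: inner_commute)
      then show ?thesis
        using f(2) \<open>i \<in> J\<close> \<open>j \<in> J\<close> assms(1) by (auto simp: inj_on_def)
    qed
    then show ?thesis by blast
  qed
  then have "\<forall>i\<in>J. \<exists>w. \<forall>j\<in>J. w \<bullet> v j = (if i = j then 1 else 0)" by (rule ballI)
  then obtain u where "\<forall>i\<in>J. \<forall>j\<in>J. u i \<bullet> v j = (if i = j then 1 else 0)"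
    by (rule bchoice[THEN exE])
  then show thesis using that[of u] by simp
qed

text \<open>Pairing with the dual family of the limit vectors recovers the coefficients, and
  replacing \<open>v\<close> by \<open>w n\<close> costs an error proportional to the coefficients
  themselves, which is absorbed. The quantifier over \<open>c\<close> stands inside
  \<open>eventually\<close>, so that the bound applies to coefficients that vary with
  \<open>n\<close> and are not known to be bounded.\<close>

lemma coefficient_bound:
  fixes v :: "'i \<Rightarrow> 'b::euclidean_space"
  assumes fin: "finite J" and ind: "inj_on v J" "independent (v ` J)"
    and w: "\<And>i. i \<in> J \<Longrightarrow> ((\<lambda>n. w n i) \<longlongrightarrow> v i) F"
  obtains K where "K > 0"
    "eventually (\<lambda>n. \<forall>c. (\<Sum>i\<in>J. \<bar>c i\<bar>) \<le> K * norm (\<Sum>i\<in>J. c i *\<^sub>R w n i)) F"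
proof -
  obtain u where u: "\<And>i j. i \<in> J \<Longrightarrow> j \<in> J \<Longrightarrow> u i \<bullet> v j = (if i = j then 1 else 0)"
    using dual_family[OF ind] by blast
  define U where "U = (\<Sum>i\<in>J. norm (u i))"
  have U0: "U \<ge> 0" unfolding U_def by (simp add: sum_nonneg)
  define D where "D = (\<lambda>n. \<Sum>i\<in>J. norm (w n i - v i))"
  have D: "(D \<longlongrightarrow> 0) F"
    unfolding D_def using w by (intro tendsto_null_sum tendsto_norm_zero) (simp add: LIM_zero)
  \<comment> \<open>Below 1/2 the error \<open>S * (U * D n)\<close> is at most half of
    \<open>S\<close> and moves to the left-hand side, which doubles \<open>U\<close>.\<close>
  have "eventually (\<lambda>n. U * D n < 1/2) F"
    using tendsto_mult_left[OF D, of U] by (intro order_tendstoD(2)[where y=0]) auto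
  then have "eventually (\<lambda>n. \<forall>c. (\<Sum>i\<in>J. \<bar>c i\<bar>) \<le> (2 * U + 1) * norm (\<Sum>i\<in>J. c i *\<^sub>R w n i)) F"
  proof eventually_elim
    case (elim n)
    show ?case
    proof
      fix c :: "'i \<Rightarrow> real"
      define S where "S = (\<Sum>i\<in>J. \<bar>c i\<bar>)"
      let ?v = "\<Sum>i\<in>J. c i *\<^sub>R v i" and ?w = "\<Sum>i\<in>J. c i *\<^sub>R w n i"
      have S0: "S \<ge> 0" unfolding S_def by (simp add: sum_nonneg)
      have "u i \<bullet> ?v = c i" if "i \<in> J" for i
        using that fin by (simp add: inner_sum_right u if_distrib sum.delta cong: if_cong)
      then have "\<bar>c i\<bar> \<le> norm (u i) * norm ?v" if "i \<in> J" for i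
        using that Cauchy_Schwarz_ineq2[of "u i" ?v] by simp
      then have 1: "S \<le> U * norm ?v"
        unfolding S_def U_def by (simp add: sum_distrib_right sum_mono)
      have "norm (?v - ?w) \<le> (\<Sum>i\<in>J. \<bar>c i\<bar> * norm (w n i - v i))"
        unfolding sum_subtractf[symmetric] scaleR_diff_right[symmetric]
        by (rule sum_norm_le) (simp add: norm_minus_commute)
      also have "\<dots> \<le> (\<Sum>i\<in>J. S * norm (w n i - v i))"
        unfolding S_def using fin by (intro sum_mono mult_right_mono member_le_sum) auto
      also have "\<dots> = S * D n" by (simp add: D_def sum_distrib_left)
      finally have "norm ?v \<le> norm ?w + S * D n"
        using norm_triangle_sub[of ?v ?w] by linarith
      then have "S \<le> U * norm ?w + S * (U * D n)"
        using 1 mult_left_mono[OF _ U0] by (smt (verit) distrib_left mult.left_commute)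
      moreover have "S * (U * D n) \<le> S * (1/2)"
        using elim S0 by (intro mult_left_mono) auto
      ultimately have "S \<le> 2 * U * norm ?w" by simp
      also have "\<dots> \<le> (2 * U + 1) * norm ?w" by (simp add: algebra_simps)
      finally show "(\<Sum>i\<in>J. \<bar>c i\<bar>) \<le> (2 * U + 1) * norm ?w" by (simp add: S_def)
    qed
  qed
  \<comment> \<open>The summand 1 keeps the constant positive when \<open>J\<close> is
    empty.\<close>
  then show thesis using that[of "2 * U + 1"] U0 by auto
qed

text \<open>The convergent sums bound the coefficients through \<open>coefficient_bound\<close>;
  pairing with the dual vector \<open>u i\<close> then isolates the i-th coefficient up to a null
  term, so its limit is \<open>u i \<bullet> s\<close>.\<close>

lemma coefficients_converge:
  fixes v :: "'i \<Rightarrow> 'b::euclidean_space"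
  assumes fin: "finite J" and ind: "inj_on v J" "independent (v ` J)"
    and w: "\<And>i. i \<in> J \<Longrightarrow> ((\<lambda>n. w n i) \<longlongrightarrow> v i) F"
    and s: "((\<lambda>n. \<Sum>i\<in>J. c n i *\<^sub>R w n i) \<longlongrightarrow> s) F"
  shows "\<exists>c0. \<forall>i\<in>J. ((\<lambda>n. c n i) \<longlongrightarrow> c0 i) F"
proof -
  obtain u where u: "\<And>i j. i \<in> J \<Longrightarrow> j \<in> J \<Longrightarrow> u i \<bullet> v j = (if i = j then 1 else 0)"
    using dual_family[OF ind] by blast
  obtain K where K: "K > 0"
    "eventually (\<lambda>n. \<forall>c. (\<Sum>i\<in>J. \<bar>c i\<bar>) \<le> K * norm (\<Sum>i\<in>J. c i *\<^sub>R w n i)) F"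
    using coefficient_bound[OF fin ind w] by blast
  let ?s = "\<lambda>n. \<Sum>i\<in>J. c n i *\<^sub>R w n i"
  have term0: "((\<lambda>n. c n j * (u i \<bullet> (w n j - v j))) \<longlongrightarrow> 0) F" if "i \<in> J" "j \<in> J" for i j
  proof (rule Lim_null_comparison)
    show "eventually (\<lambda>n. norm (c n j * (u i \<bullet> (w n j - v j)))
        \<le> (K * norm (?s n)) * \<bar>u i \<bullet> (w n j - v j)\<bar>) F"
      using K(2)
    proof eventually_elim
      case (elim n)
      have "\<bar>c n j\<bar> \<le> (\<Sum>i\<in>J. \<bar>c n i\<bar>)"
        using fin that by (intro member_le_sum) auto
      also have "\<dots> \<le> K * norm (?s n)" using elim by blast
      finally show ?case by (simp add: abs_mult mult_right_mono)
    qed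
    have "((\<lambda>n. (K * norm (?s n)) * \<bar>u i \<bullet> (w n j - v j)\<bar>) \<longlongrightarrow> (K * norm s) * \<bar>u i \<bullet> (v j - v j)\<bar>) F"
      using that by (intro tendsto_intros s w)
    then show "((\<lambda>n. (K * norm (?s n)) * \<bar>u i \<bullet> (w n j - v j)\<bar>) \<longlongrightarrow> 0) F" by simp
  qed
  have "((\<lambda>n. c n i) \<longlongrightarrow> u i \<bullet> s) F" if i: "i \<in> J" for i
  proof -
    have "c n i = u i \<bullet> ?s n - (\<Sum>j\<in>J. c n j * (u i \<bullet> (w n j - v j)))" for n
    proof -
      have "(\<Sum>j\<in>J. c n j * (u i \<bullet> v j)) = c n i"
        using i fin by (simp add: u if_distrib sum.delta cong: if_cong)
      then show ?thesis
        by (simp add: inner_sum_right inner_diff_right right_diff_distrib sum_subtractf)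
    qed
    moreover have "((\<lambda>n. u i \<bullet> ?s n - (\<Sum>j\<in>J. c n j * (u i \<bullet> (w n j - v j)))) \<longlongrightarrow> u i \<bullet> s - 0) F"
      using i term0 by (intro tendsto_diff tendsto_inner tendsto_const s tendsto_null_sum)
    ultimately show ?thesis by simp
  qed
  then show ?thesis by (intro exI[of _ "\<lambda>i. u i \<bullet> s"]) blast
qed

lemma span_image_finite:
  assumes "finite J" "inj_on v J" "p \<in> span (v ` J)"
  obtains c where "p = (\<Sum>i\<in>J. c i *\<^sub>R v i)"
proof -
  obtain c where "p = (\<Sum>a\<in>v ` J. c a *\<^sub>R a)"
    using assms by (auto simp: span_finite)
  then have "p = (\<Sum>i\<in>J. c (v i) *\<^sub>R v i)"
    using assms(2) by (simp add: sum.reindex)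
  then show thesis by (rule that)
qed

text \<open>Take for \<open>e n\<close> the component of \<open>d\<close> orthogonal to all
  \<open>w n i\<close>. The removed part \<open>p n\<close> satisfies |p|^2 = p \<bullet> d, which
  is at most K |p| times the sum of the |w n i \<bullet> d|; dividing by |p| shows that it vanishes
  in the limit.\<close>

lemma approximate_orthogonal:
  fixes v :: "'i \<Rightarrow> 'b::euclidean_space"
  assumes fin: "finite J" and ind: "inj_on v J" "independent (v ` J)"
    and w: "\<And>i. i \<in> J \<Longrightarrow> ((\<lambda>n. w n i) \<longlongrightarrow> v i) F"
    and d: "\<And>i. i \<in> J \<Longrightarrow> v i \<bullet> d = 0"
  shows "\<exists>e. (e \<longlongrightarrow> d) F \<and> (\<forall>n. \<forall>i\<in>J. w n i \<bullet> e n = 0)"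
proof -
  obtain K where K: "K > 0"
    "eventually (\<lambda>n. \<forall>c. (\<Sum>i\<in>J. \<bar>c i\<bar>) \<le> K * norm (\<Sum>i\<in>J. c i *\<^sub>R w n i)) F"
    using coefficient_bound[OF fin ind w] by blast
  have "\<exists>p q. p \<in> span (w n ` J) \<and> (\<forall>x\<in>span (w n ` J). orthogonal q x) \<and> d = p + q" for n
    using orthogonal_subspace_decomp_exists[of "w n ` J" d] by metis
  then obtain p q where pq: "\<And>n. p n \<in> span (w n ` J)" "\<And>n x. x \<in> span (w n ` J) \<Longrightarrow> q n \<bullet> x = 0"
    "\<And>n. d = p n + q n"
    unfolding orthogonal_def by metis
  have "\<exists>c. p n = (\<Sum>i\<in>J. c i *\<^sub>R w n i)" for n
  proof -
    obtain c where c: "p n = (\<Sum>a\<in>w n ` J. c a *\<^sub>R a)"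
      using pq(1)[of n] fin by (auto simp: span_finite)
    \<comment> \<open>For some \<open>n\<close> the family \<open>w n\<close> may fail to be
      injective, so the sum over its image is rewritten over a subset of indices on which it
      is.\<close>
    obtain J' where J': "J' \<subseteq> J" "inj_on (w n) J'" "w n ` J = w n ` J'"
      by (metis subset_image_inj subset_refl)
    have "p n = (\<Sum>i\<in>J'. c (w n i) *\<^sub>R w n i)"
      unfolding c J'(3) using J'(2) by (simp add: sum.reindex)
    also have "\<dots> = (\<Sum>i\<in>J. (if i \<in> J' then c (w n i) else 0) *\<^sub>R w n i)"
      using J'(1) fin by (intro sum.mono_neutral_cong_left) auto
    finally show ?thesis by (intro exI[of _ "\<lambda>i. if i \<in> J' then c (w n i) else 0"])
  qed
  then have "\<exists>c. \<forall>n. p n = (\<Sum>i\<in>J. c n i *\<^sub>R w n i)" by (intro choice allI)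
  then obtain c where c: "\<And>n. p n = (\<Sum>i\<in>J. c n i *\<^sub>R w n i)" by (elim exE) simp
  define B where "B = (\<lambda>n. \<Sum>i\<in>J. \<bar>w n i \<bullet> d\<bar>)"
  have B: "(B \<longlongrightarrow> 0) F"
    unfolding B_def
  proof (rule tendsto_null_sum)
    fix i assume "i \<in> J"
    then have "((\<lambda>n. \<bar>w n i \<bullet> d\<bar>) \<longlongrightarrow> \<bar>v i \<bullet> d\<bar>) F" by (intro tendsto_intros w)
    then show "((\<lambda>n. \<bar>w n i \<bullet> d\<bar>) \<longlongrightarrow> 0) F" using d \<open>i \<in> J\<close> by simp
  qed
  have "(p \<longlongrightarrow> 0) F"
  proof (rule Lim_null_comparison)
    show "((\<lambda>n. K * B n) \<longlongrightarrow> 0) F" using tendsto_mult_left[OF B, of K] by simp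
    show "eventually (\<lambda>n. norm (p n) \<le> K * B n) F"
      using K(2)
    proof eventually_elim
      case (elim n)
      have "(norm (p n))\<^sup>2 = p n \<bullet> d"
        using pq(2)[OF pq(1)[of n]]
        by (simp add: pq(3)[of n] inner_add_right inner_commute[of "p n" "q n"] power2_norm_eq_inner)
      also have "\<dots> = (\<Sum>i\<in>J. c n i * (w n i \<bullet> d))" by (subst c) (simp add: inner_sum_left)
      also have "\<dots> \<le> (\<Sum>i\<in>J. \<bar>c n i\<bar> * B n)"
      proof (rule sum_mono)
        fix i assume "i \<in> J"
        then have "\<bar>w n i \<bullet> d\<bar> \<le> B n" unfolding B_def using fin by (intro member_le_sum) auto
        then show "c n i * (w n i \<bullet> d) \<le> \<bar>c n i\<bar> * B n"
          using mult_left_mono[of "\<bar>w n i \<bullet> d\<bar>" "B n" "\<bar>c n i\<bar>"] abs_ge_self[of "c n i * (w n i \<bullet> d)"]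
          by (simp add: abs_mult)
      qed
      also have "\<dots> = (\<Sum>i\<in>J. \<bar>c n i\<bar>) * B n" by (simp add: sum_distrib_right)
      also have "\<dots> \<le> (K * norm (p n)) * B n"
        using elim c[of n] by (intro mult_right_mono) (auto simp: B_def sum_nonneg)
      finally have le: "norm (p n) * norm (p n) \<le> norm (p n) * (K * B n)"
        by (simp add: power2_eq_square mult_ac)
      have "0 \<le> K * B n" using K(1) by (simp add: B_def sum_nonneg)
      then show ?case using le by (cases "norm (p n) = 0") auto
    qed
  qed
  then have "((\<lambda>n. d - p n) \<longlongrightarrow> d - 0) F" by (intro tendsto_intros)
  moreover have "d - p n = q n" for n using pq(3)[of n] by (metis add_diff_cancel_left')
  ultimately have "(q \<longlongrightarrow> d) F" by simp
  moreover have "w n i \<bullet> q n = 0" if "i \<in> J" for n i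
    using pq(2)[of "w n i" n] that by (simp add: span_base inner_commute)
  ultimately show ?thesis by (intro exI[of _ q]) blast
qed

section \<open>Parametric families of class $C^2$\<close>

text \<open>Glues local extensions: a smooth extension is given around each point separately, and
  different points may come with different ones.\<close>

lemma continuous_on_locally_eq:
  assumes "\<And>p. p \<in> S \<Longrightarrow> \<exists>W G. open W \<and> p \<in> W \<and> continuous_on W G \<and> (\<forall>z\<in>W \<inter> S. f z = G z)"
  shows "continuous_on S f"
  unfolding continuous_on_def
proof
  fix p assume p: "p \<in> S"
  then obtain W G where W: "open W" "p \<in> W" "continuous_on W G" "\<forall>z\<in>W \<inter> S. f z = G z"
    using assms by blast
  have "G \<midarrow>p\<rightarrow> f p"
    using W p by (metis IntI at_within_open continuous_on_def)
  then have "(G \<longlongrightarrow> f p) (at p within S)"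
    by (rule Lim_at_imp_Lim_at_within)
  moreover have "eventually (\<lambda>z. G z = f z) (at p within S)"
    unfolding eventually_at_topological using W by (intro exI[of _ W]) auto
  ultimately show "(f \<longlongrightarrow> f p) (at p within S)"
    by (rule Lim_transform_eventually)
qed

lemma grad_eqI: "GDERIV f y :> D \<Longrightarrow> grad f y = D"
  unfolding grad_def
proof (rule the_equality)
  fix D' assume "GDERIV f y :> D" "GDERIV f y :> D'"
  then have "(\<lambda>h. h \<bullet> D') = (\<lambda>h. h \<bullet> D)"
    unfolding gderiv_def by (rule has_derivative_unique[rotated])
  then show "D' = D" by (metis inner_commute vector_eq_ldot)
qed

lemma hessian_eqI:
  assumes "(grad f has_derivative D) (at y)"
  shows "hessian f y = matrix D"
  by (simp only: hessian_def frechet_derivative_at[OF assms, symmetric])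

text \<open>All that later arguments retain of smoothness. The differentiability clauses are needed
  beside continuity because \<open>grad\<close> and \<open>hessian\<close> are total and take some
  value even where no derivative exists.\<close>

definition C2_family :: "'a::topological_space set \<Rightarrow> ('a \<Rightarrow> real^'m \<Rightarrow> real) \<Rightarrow> bool" where
  "C2_family X f \<longleftrightarrow>
     (\<forall>x\<in>X. \<forall>y. GDERIV (f x) y :> grad (f x) y \<and>
        (grad (f x) has_derivative (*v) (hessian (f x) y)) (at y)) \<and>
     continuous_on (X \<times> UNIV) (\<lambda>(x, y). f x y) \<and>
     continuous_on (X \<times> UNIV) (\<lambda>(x, y). grad (f x) y) \<and>
     continuous_on (X \<times> UNIV) (\<lambda>(x, y). hessian (f x) y)"

text \<open>For \<open>x\<close> in \<open>X\<close> the function \<open>f x\<close> agrees with the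
  extension \<open>F\<close> on the open slice of \<open>W\<close> over \<open>x\<close>. Composing
  the derivatives of \<open>F\<close> with the embedding y -> (x, y) therefore gives those of
  \<open>f x\<close>, and they inherit joint continuity from \<open>F\<close>.\<close>

lemma smooth_on_local_derivatives:
  fixes f :: "'a::real_normed_vector \<Rightarrow> real^'m \<Rightarrow> real"
  assumes "smooth_on (X \<times> UNIV) (\<lambda>(x, y). f x y)" and "x0 \<in> X"
  obtains W F G H where "open W" "(x0, y0) \<in> W"
    "continuous_on W F" "continuous_on W G" "continuous_on W H"
    "\<And>x y. x \<in> X \<Longrightarrow> (x, y) \<in> W \<Longrightarrow> f x y = F (x, y)"
    "\<And>x y. x \<in> X \<Longrightarrow> (x, y) \<in> W \<Longrightarrow> GDERIV (f x) y :> G (x, y)"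
    "\<And>x y. x \<in> X \<Longrightarrow> (x, y) \<in> W \<Longrightarrow> (grad (f x) has_derivative (*v) (H (x, y))) (at y)"
proof -
  obtain W F where W: "(x0, y0) \<in> W" "smooth_on_open W F"
    and eq: "\<forall>z\<in>W \<inter> X \<times> UNIV. F z = (\<lambda>(x, y). f x y) z"
    using assms unfolding smooth_on_def by blast
  have oW: "open W" and Ck: "\<And>n. Ck_on n W F" using W(2) unfolding smooth_on_open_def by auto
  define P where "P = (\<lambda>z v. frechet_derivative F (at z) v)"
  define Q where "Q = (\<lambda>z v w. frechet_derivative (\<lambda>z. P z v) (at z) w)"
  have dF: "(F has_derivative P z) (at z)" if "z \<in> W" for z
    using Ck[of 1] that unfolding P_def by (auto simp: frechet_derivative_works)
  have dP: "((\<lambda>z. P z v) has_derivative Q z v) (at z)" if "z \<in> W" for z v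
    using Ck[of "Suc (Suc 0)"] that unfolding P_def Q_def
    by (simp add: frechet_derivative_works del: split_paired_All)
  have cF: "continuous_on W F" using Ck[of 0] by simp
  have cP: "continuous_on W (\<lambda>z. P z v)" for v using Ck[of 1] unfolding P_def by (simp del: split_paired_All)
  have cQ: "continuous_on W (\<lambda>z. Q z v w)" for v w
    using Ck[of "Suc (Suc 0)"] unfolding P_def Q_def by (simp del: split_paired_All)
  \<comment> \<open>The coordinates of the partial gradient are the derivatives of \<open>F\<close>
    in the directions \<open>(0, b)\<close>.\<close>
  define G where "G = (\<lambda>z. \<Sum>b\<in>(Basis :: (real^'m) set). P z (0, b) *\<^sub>R b)"
  define D where "D = (\<lambda>z d. \<Sum>b\<in>(Basis :: (real^'m) set). Q z (0, b) (0, d) *\<^sub>R b)"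
  define H where "H = (\<lambda>z. matrix (D z))"
  have slice: "((\<lambda>y. (x, y)) has_derivative (\<lambda>d. (0, d))) (at y)" for x :: 'a and y :: "real^'m"
    by (auto intro!: derivative_eq_intros)
  have open_slice: "open {y. (x, y) \<in> W}" for x
    using open_vimage[OF oW, of "\<lambda>y. (x, y)"] by (simp add: vimage_def continuous_on_Pair)
  have gF: "GDERIV (f x) y :> G (x, y)" if x: "x \<in> X" and y: "(x, y) \<in> W" for x y
  proof -
    have "P (x, y) (0, d) = d \<bullet> G (x, y)" for d
    proof -
      have lin: "linear (\<lambda>d. P (x, y) (0, d))"
        using has_derivative_compose[OF slice dF[OF y]] has_derivative_linear by blast
      have "P (x, y) (0, \<Sum>b\<in>Basis. (d \<bullet> b) *\<^sub>R b) = (\<Sum>b\<in>Basis. (d \<bullet> b) *\<^sub>R P (x, y) (0, b))"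
        using linear_sum[OF lin, of "\<lambda>b. (d \<bullet> b) *\<^sub>R b" Basis] linear_scale[OF lin] by simp
      then show ?thesis
        by (simp add: euclidean_representation G_def inner_sum_right mult.commute)
    qed
    then have "((\<lambda>y. F (x, y)) has_derivative (\<lambda>d. d \<bullet> G (x, y))) (at y)"
      using has_derivative_compose[OF slice dF[OF y]] by simp
    then show ?thesis
      unfolding gderiv_def
      by (rule has_derivative_transform_within_open[OF _ open_slice]) (use y x eq in auto)
  qed
  have gG: "(grad (f x) has_derivative (*v) (H (x, y))) (at y)" if x: "x \<in> X" and y: "(x, y) \<in> W" for x y
  proof -
    have "(G has_derivative (\<lambda>w. \<Sum>b\<in>Basis. Q (x, y) (0, b) w *\<^sub>R b)) (at (x, y))"
      unfolding G_def by (intro has_derivative_sum has_derivative_scaleR_left dP[OF y])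
    from has_derivative_compose[OF slice this]
    have *: "((\<lambda>y. G (x, y)) has_derivative D (x, y)) (at y)"
      by (simp add: D_def)
    then have "(*v) (H (x, y)) = D (x, y)"
      unfolding H_def using has_derivative_bounded_linear by (intro matrix_vector_mul(3)) blast
    then show ?thesis
      using has_derivative_transform_within_open[OF * open_slice[of x], of "grad (f x)"]
        y grad_eqI[OF gF[OF x]] by auto
  qed
  show thesis
  proof (rule that[OF oW W(1) cF, of G H])
    show "continuous_on W G" unfolding G_def by (intro continuous_intros cP)
    show "continuous_on W H"
      unfolding H_def matrix_def D_def by (simp add: sum_component) (intro continuous_intros cQ)
  qed (use gF gG eq in auto)
qed

lemma smooth_on_imp_C2_family:
  fixes f :: "'a::real_normed_vector \<Rightarrow> real^'m \<Rightarrow> real"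
  assumes smooth: "smooth_on (X \<times> UNIV) (\<lambda>(x, y). f x y)"
  shows "C2_family X f"
proof -
  have *: "GDERIV (f x) y :> grad (f x) y \<and> (grad (f x) has_derivative (*v) (hessian (f x) y)) (at y) \<and>
      (\<exists>W F. open W \<and> (x, y) \<in> W \<and> continuous_on W F \<and> (\<forall>z\<in>W \<inter> X \<times> UNIV. (\<lambda>(x, y). f x y) z = F z)) \<and>
      (\<exists>W F. open W \<and> (x, y) \<in> W \<and> continuous_on W F \<and> (\<forall>z\<in>W \<inter> X \<times> UNIV. (\<lambda>(x, y). grad (f x) y) z = F z)) \<and>
      (\<exists>W F. open W \<and> (x, y) \<in> W \<and> continuous_on W F \<and> (\<forall>z\<in>W \<inter> X \<times> UNIV. (\<lambda>(x, y). hessian (f x) y) z = F z))"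
    if x: "x \<in> X" for x y
  proof (rule smooth_on_local_derivatives[OF smooth x, of y], intro conjI)
    fix W F G H
    assume W: "open W" "(x, y) \<in> W"
      and c: "continuous_on W F" "continuous_on W G" "continuous_on W H"
      and F: "\<And>x y. x \<in> X \<Longrightarrow> (x, y) \<in> W \<Longrightarrow> f x y = F (x, y)"
      and G: "\<And>x y. x \<in> X \<Longrightarrow> (x, y) \<in> W \<Longrightarrow> GDERIV (f x) y :> G (x, y)"
      and H: "\<And>x y. x \<in> X \<Longrightarrow> (x, y) \<in> W \<Longrightarrow> (grad (f x) has_derivative (*v) (H (x, y))) (at y)"
    have G': "grad (f x) y = G (x, y)" and H': "hessian (f x) y = H (x, y)"
      if "x \<in> X" "(x, y) \<in> W" for x y
      using grad_eqI[OF G[OF that]] hessian_eqI[OF H[OF that]] by simp_all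
    show "GDERIV (f x) y :> grad (f x) y" using G[OF x W(2)] G'[OF x W(2)] by simp
    show "(grad (f x) has_derivative (*v) (hessian (f x) y)) (at y)"
      using H[OF x W(2)] H'[OF x W(2)] by simp
    show "\<exists>W F. open W \<and> (x, y) \<in> W \<and> continuous_on W F \<and> (\<forall>z\<in>W \<inter> X \<times> UNIV. (\<lambda>(x, y). f x y) z = F z)"
      using W c(1) F by (intro exI[of _ W] exI[of _ F]) auto
    show "\<exists>W F. open W \<and> (x, y) \<in> W \<and> continuous_on W F \<and> (\<forall>z\<in>W \<inter> X \<times> UNIV. (\<lambda>(x, y). grad (f x) y) z = F z)"
      using W c(2) G' by (intro exI[of _ W] exI[of _ G]) auto
    show "\<exists>W F. open W \<and> (x, y) \<in> W \<and> continuous_on W F \<and> (\<forall>z\<in>W \<inter> X \<times> UNIV. (\<lambda>(x, y). hessian (f x) y) z = F z)"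
      using W c(3) H' by (intro exI[of _ W] exI[of _ H]) auto
  qed
  show ?thesis
    unfolding C2_family_def
  proof (intro conjI continuous_on_locally_eq ballI allI)
    fix p assume "p \<in> X \<times> (UNIV :: (real^'m) set)"
    then obtain x y where p: "p = (x, y)" "x \<in> X" by auto
    note ** = *[OF p(2), of y, folded p(1)]
    show "\<exists>W F. open W \<and> p \<in> W \<and> continuous_on W F \<and> (\<forall>z\<in>W \<inter> X \<times> UNIV. (\<lambda>(x, y). f x y) z = F z)"
      "\<exists>W F. open W \<and> p \<in> W \<and> continuous_on W F \<and> (\<forall>z\<in>W \<inter> X \<times> UNIV. (\<lambda>(x, y). grad (f x) y) z = F z)"
      "\<exists>W F. open W \<and> p \<in> W \<and> continuous_on W F \<and> (\<forall>z\<in>W \<inter> X \<times> UNIV. (\<lambda>(x, y). hessian (f x) y) z = F z)"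
      using ** by simp_all
  qed (simp_all add: *)
qed

section \<open>Expansions along segments and limits of difference quotients\<close>

lemma segment_mean_value:
  fixes f :: "'b::real_inner \<Rightarrow> real"
  assumes "\<And>y. GDERIV f y :> grad f y"
  obtains t where "0 < t" "t < 1" "f z - f y = grad f (y + t *\<^sub>R (z - y)) \<bullet> (z - y)"
proof -
  define \<phi> where "\<phi> = (\<lambda>t. f (y + t *\<^sub>R (z - y)))"
  have "(\<phi> has_real_derivative grad f (y + t *\<^sub>R (z - y)) \<bullet> (z - y)) (at t)" for t
  proof -
    have "((\<lambda>t. y + t *\<^sub>R (z - y)) has_derivative (\<lambda>s. s *\<^sub>R (z - y))) (at t)"
      by (auto intro!: derivative_eq_intros)
    from has_derivative_compose[OF this assms[unfolded gderiv_def]] show ?thesis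
      unfolding \<phi>_def has_field_derivative_def
      by (simp add: inner_commute mult.commute[of _ "_ \<bullet> _"])
  qed
  from MVT2[of 0 1 \<phi>, OF _ this] show thesis
    using that by (auto simp: \<phi>_def)
qed

lemma segment_taylor2:
  fixes f :: "real^'m \<Rightarrow> real"
  assumes "\<And>y. GDERIV f y :> grad f y"
    and "\<And>y. (grad f has_derivative (*v) (hessian f y)) (at y)"
  obtains t where "0 < t" "t < 1"
    "f z - f y = grad f y \<bullet> (z - y) + (z - y) \<bullet> (hessian f (y + t *\<^sub>R (z - y)) *v (z - y)) / 2"
proof -
  define p where "p = (\<lambda>t. y + t *\<^sub>R (z - y))"
  \<comment> \<open>The derivatives of t -> f (p t) of orders 0, 1 and 2; the expansion to order 2
    consults no others.\<close>
  define diff where "diff = (\<lambda>(m::nat) t. if m = 0 then f (p t) else if m = 1 then grad f (p t) \<bullet> (z - y)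
    else (z - y) \<bullet> (hessian f (p t) *v (z - y)) :: real)"
  have p: "(p has_derivative (\<lambda>s. s *\<^sub>R (z - y))) (at t)" for t
    unfolding p_def by (auto intro!: derivative_eq_intros)
  have "(diff 0 has_real_derivative diff 1 t) (at t)" for t
    using has_derivative_compose[OF p assms(1)[unfolded gderiv_def]]
    unfolding diff_def has_field_derivative_def
    by (simp add: inner_commute mult.commute[of _ "_ \<bullet> _"])
  moreover have "(diff 1 has_real_derivative diff 2 t) (at t)" for t
    using has_derivative_inner_left[OF has_derivative_compose[OF p assms(2)], of "z - y"]
    unfolding diff_def has_field_derivative_def
    by (simp add: inner_commute matrix_vector_mult_scaleR mult.commute[of _ "_ \<bullet> _"])
  ultimately have "\<forall>m t. m < 2 \<and> 0 \<le> t \<and> t \<le> 1 \<longrightarrow> DERIV (diff m) t :> diff (Suc m) t"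
    by (auto simp: less_Suc_eq numeral_2_eq_2)
  from Maclaurin[of 1 2 diff "diff 0", OF _ _ refl this]
  obtain t where "0 < t" "t < 1"
    "diff 0 1 = (\<Sum>m<2. (diff m 0 / fact m) * 1 ^ m) + (diff 2 t / fact 2) * 1 ^ 2" by auto
  then show thesis
    by (intro that[of t]) (auto simp: diff_def p_def numeral_2_eq_2)
qed

lemma C2_family_GDERIV: "C2_family X f \<Longrightarrow> x \<in> X \<Longrightarrow> GDERIV (f x) y :> grad (f x) y"
  by (simp add: C2_family_def)

lemma C2_family_grad_derivative:
  "C2_family X f \<Longrightarrow> x \<in> X \<Longrightarrow> (grad (f x) has_derivative (*v) (hessian (f x) y)) (at y)"
  by (simp add: C2_family_def)

text \<open>The filter is arbitrary so as to cover sequences of parameters, one-sided limits along a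
  ray at a fixed parameter, and continuity in \<open>y\<close>.\<close>

lemma C2_family_tendsto:
  assumes f: "C2_family X f" and x: "x \<in> X" "(xs \<longlongrightarrow> x) F" "eventually (\<lambda>n. xs n \<in> X) F"
    and y: "(ys \<longlongrightarrow> y) F"
  shows "((\<lambda>n. f (xs n) (ys n)) \<longlongrightarrow> f x y) F"
    and "((\<lambda>n. grad (f (xs n)) (ys n)) \<longlongrightarrow> grad (f x) y) F"
    and "((\<lambda>n. hessian (f (xs n)) (ys n)) \<longlongrightarrow> hessian (f x) y) F"
proof -
  have ev: "eventually (\<lambda>n. (xs n, ys n) \<in> X \<times> UNIV) F" using x(3) by simp
  show "((\<lambda>n. f (xs n) (ys n)) \<longlongrightarrow> f x y) F"
    using continuous_on_tendsto_compose[OF _ tendsto_Pair[OF x(2) y] _ ev, of "\<lambda>(x, y). f x y"]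
      f x(1) by (simp add: C2_family_def)
  show "((\<lambda>n. grad (f (xs n)) (ys n)) \<longlongrightarrow> grad (f x) y) F"
    using continuous_on_tendsto_compose[OF _ tendsto_Pair[OF x(2) y] _ ev, of "\<lambda>(x, y). grad (f x) y"]
      f x(1) by (simp add: C2_family_def)
  show "((\<lambda>n. hessian (f (xs n)) (ys n)) \<longlongrightarrow> hessian (f x) y) F"
    using continuous_on_tendsto_compose[OF _ tendsto_Pair[OF x(2) y] _ ev, of "\<lambda>(x, y). hessian (f x) y"]
      f x(1) by (simp add: C2_family_def)
qed

lemma segment_point_tendsto:
  fixes ys zs :: "'i \<Rightarrow> 'b::real_normed_vector"
  assumes "(ys \<longlongrightarrow> y) F" "(zs \<longlongrightarrow> y) F" "\<And>n. 0 < t n" "\<And>n. t n < (1::real)"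
  shows "((\<lambda>n. ys n + t n *\<^sub>R (zs n - ys n)) \<longlongrightarrow> y) F"
proof -
  have diff: "((\<lambda>n. norm (zs n - ys n)) \<longlongrightarrow> 0) F"
    using tendsto_norm[OF tendsto_diff[OF assms(2,1)]] by simp
  have "((\<lambda>n. t n *\<^sub>R (zs n - ys n)) \<longlongrightarrow> 0) F"
  proof (rule Lim_null_comparison[OF always_eventually diff], rule allI)
    fix n
    show "norm (t n *\<^sub>R (zs n - ys n)) \<le> norm (zs n - ys n)"
      using assms(3,4)[of n] by (simp add: mult_left_le_one_le)
  qed
  from tendsto_add[OF assms(1) this] show ?thesis by simp
qed

text \<open>Parameter, base point and increment all move, so differentiability at the limit would
  not suffice. The mean value theorem gives each quotient exactly, as a gradient at an intermediate
  point, and joint continuity of the gradient does the rest.\<close>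

lemma C2_family_difference_quotient:
  assumes f: "C2_family X f" and x: "x \<in> X" "(xs \<longlongrightarrow> x) F" "\<And>n. xs n \<in> X"
    and y: "(ys \<longlongrightarrow> y) F" "(zs \<longlongrightarrow> y) F"
    and d: "((\<lambda>n. (zs n - ys n) /\<^sub>R norm (zs n - ys n)) \<longlongrightarrow> d) F"
  shows "((\<lambda>n. (f (xs n) (zs n) - f (xs n) (ys n)) / norm (zs n - ys n)) \<longlongrightarrow> grad (f x) y \<bullet> d) F"
proof -
  have "\<exists>t. 0 < t \<and> t < 1 \<and> f (xs n) (zs n) - f (xs n) (ys n)
      = grad (f (xs n)) (ys n + t *\<^sub>R (zs n - ys n)) \<bullet> (zs n - ys n)" for n
    using segment_mean_value[OF C2_family_GDERIV[OF f x(3)], of n "zs n" "ys n"] by blast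
  then obtain t where t: "\<And>n. 0 < t n" "\<And>n. t n < 1"
    "\<And>n. f (xs n) (zs n) - f (xs n) (ys n) = grad (f (xs n)) (ys n + t n *\<^sub>R (zs n - ys n)) \<bullet> (zs n - ys n)"
    by metis
  have "((\<lambda>n. grad (f (xs n)) (ys n + t n *\<^sub>R (zs n - ys n)) \<bullet> ((zs n - ys n) /\<^sub>R norm (zs n - ys n)))
      \<longlongrightarrow> grad (f x) y \<bullet> d) F"
    using x segment_point_tendsto[OF y t(1,2)]
    by (intro tendsto_inner d C2_family_tendsto(2)[OF f]) auto
  then show ?thesis by (simp add: t(3) divide_inverse mult.commute)
qed

section \<open>First-order necessary conditions\<close>

lemma descent_direction:
  assumes "GDERIV f y :> D" "D \<bullet> d < 0"
  shows "eventually (\<lambda>t. f (y + t *\<^sub>R d) < f y) (at_right 0)"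
proof -
  have "((\<lambda>t. y + t *\<^sub>R d) has_derivative (\<lambda>s. s *\<^sub>R d)) (at 0)"
    by (auto intro!: derivative_eq_intros)
  moreover have "(f has_derivative (\<lambda>h. h \<bullet> D)) (at (y + 0 *\<^sub>R d))"
    using assms(1) by (simp add: gderiv_def)
  ultimately have "((\<lambda>t. f (y + t *\<^sub>R d)) has_derivative (\<lambda>s. (s *\<^sub>R d) \<bullet> D)) (at 0)"
    by (rule has_derivative_compose)
  then have "((\<lambda>t. f (y + t *\<^sub>R d)) has_real_derivative D \<bullet> d) (at 0)"
    by (simp add: has_field_derivative_def inner_commute mult.commute[of _ "_ \<bullet> _"])
  from DERIV_neg_dec_right[OF this assms(2)] show ?thesis
    by (auto simp: eventually_at_right_field)
qed

lemma matrix_vector_mult_sum: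
  fixes A :: "'i \<Rightarrow> real^'n^'m"
  shows "(\<Sum>i\<in>S. c i *\<^sub>R A i) *v d = (\<Sum>i\<in>S. c i *\<^sub>R (A i *v d))"
  by (induction S rule: infinite_finite_induct)
    (simp_all add: matrix_vector_mult_add_rdistrib scaleR_matrix_vector_assoc)

lemma tendsto_matrix_vector_mult:
  fixes A :: "'i \<Rightarrow> real^'n^'m"
  assumes "(A \<longlongrightarrow> B) F" "(v \<longlongrightarrow> w) F"
  shows "((\<lambda>n. A n *v v n) \<longlongrightarrow> B *v w) F"
  unfolding matrix_vector_mult_def by (intro tendsto_intros assms)

text \<open>Active constraints decrease to first order along \<open>d\<close>, and inactive ones
  stay negative by continuity.\<close>

lemma feasible_eventually_interior:
  assumes h: "\<And>i. i \<in> {1..k} \<Longrightarrow> C2_family X (h i)" and x: "x \<in> X" "y \<in> feasible k h x"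
    and d: "\<And>i. i \<in> active_set k h x y \<Longrightarrow> grad (h i x) y \<bullet> d < 0"
  shows "eventually (\<lambda>t. \<forall>i\<in>{1..k}. h i x (y + t *\<^sub>R d) < 0) (at_right 0)"
proof (rule eventually_ball_finite, simp, rule ballI)
  fix i assume i: "i \<in> {1..k}"
  show "eventually (\<lambda>t. h i x (y + t *\<^sub>R d) < 0) (at_right 0)"
  proof (cases "i \<in> active_set k h x y")
    case True
    then show ?thesis
      using descent_direction[OF C2_family_GDERIV[OF h[OF i] x(1)] d[OF True]]
      by (simp add: active_set_def)
  next
    case False
    then have neg: "h i x y < 0" using i x(2) by (force simp: active_set_def feasible_def)
    have "((\<lambda>t. y + t *\<^sub>R d) \<longlongrightarrow> y + 0 *\<^sub>R d) (at_right 0)" by (intro tendsto_intros)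
    then have "((\<lambda>t. h i x (y + t *\<^sub>R d)) \<longlongrightarrow> h i x y) (at_right 0)"
      using x(1) by (intro C2_family_tendsto(1)[OF h[OF i], of x "\<lambda>_. x"]) auto
    then show ?thesis using neg by (rule order_tendstoD(2))
  qed
qed

text \<open>This is the Mangasarian-Fromovitz condition; minus the sum of the dual vectors is such a
  direction.\<close>

lemma LICQ_interior_direction:
  fixes h :: "nat \<Rightarrow> 'a \<Rightarrow> 'b::euclidean_space \<Rightarrow> real"
  assumes "LICQ k h x" "y \<in> feasible k h x"
  obtains e where "\<And>i. i \<in> active_set k h x y \<Longrightarrow> grad (h i x) y \<bullet> e = - 1"
proof -
  let ?A = "active_set k h x y"
  have ind: "inj_on (\<lambda>i. grad (h i x) y) ?A" "independent ((\<lambda>i. grad (h i x) y) ` ?A)"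
    using assms by (auto simp: LICQ_def)
  obtain u where u: "\<And>i j. i \<in> ?A \<Longrightarrow> j \<in> ?A \<Longrightarrow> u i \<bullet> grad (h j x) y = (if i = j then 1 else 0)"
    using dual_family[OF ind] by metis
  have fin: "finite ?A" by (simp add: active_set_def)
  show thesis
  proof (rule that[of "- (\<Sum>i\<in>?A. u i)"])
    fix j assume "j \<in> ?A"
    then show "grad (h j x) y \<bullet> - (\<Sum>i\<in>?A. u i) = - 1"
      using fin by (simp add: inner_sum_right u inner_commute[of "grad (h j x) y"] cong: sum.cong)
  qed
qed

text \<open>Minimality forbids descent along strictly feasible directions, and tilting by
  \<open>e\<close> extends this to the closed linearized cone. Testing that cone with chosen
  directions puts the gradient of the objective in the span of the active gradients and fixes the
  signs of its coefficients.\<close>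

lemma KKT_necessary:
  assumes g: "C2_family X g" and h: "\<And>i. i \<in> {1..k} \<Longrightarrow> C2_family X (h i)" and x: "x \<in> X"
    and licq: "LICQ k h x" and min: "local_minimizer g k h x y"
  obtains l where "KKT_pair g k h x y l"
proof -
  let ?A = "active_set k h x y" and ?G = "grad (g x) y" and ?v = "\<lambda>i. grad (h i x) y"
  have feas: "y \<in> feasible k h x" using min by (simp add: local_minimizer_def)
  have fin: "finite ?A" by (simp add: active_set_def)
  have ind: "inj_on ?v ?A" "independent (?v ` ?A)"
    using licq feas by (auto simp: LICQ_def)
  obtain u where u: "\<And>i j. i \<in> ?A \<Longrightarrow> j \<in> ?A \<Longrightarrow> u i \<bullet> ?v j = (if i = j then 1 else 0)"
    using dual_family[OF ind] by metis
  obtain e where e: "\<And>i. i \<in> ?A \<Longrightarrow> ?v i \<bullet> e = - 1"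
    using LICQ_interior_direction[OF licq feas] by metis
  have no_descent: "\<not> (?G \<bullet> d < 0)" if d: "\<And>i. i \<in> ?A \<Longrightarrow> ?v i \<bullet> d < 0" for d
  proof
    assume "?G \<bullet> d < 0"
    from descent_direction[OF C2_family_GDERIV[OF g x] this]
    have dec: "eventually (\<lambda>t. g x (y + t *\<^sub>R d) < g x y) (at_right 0)" .
    obtain \<epsilon> where \<epsilon>: "\<epsilon> > 0" "\<And>z. z \<in> feasible k h x \<inter> ball y \<epsilon> \<Longrightarrow> g x y \<le> g x z"
      using min by (auto simp: local_minimizer_def)
    have "((\<lambda>t. y + t *\<^sub>R d) \<longlongrightarrow> y + 0 *\<^sub>R d) (at_right 0)" by (intro tendsto_intros)
    then have "eventually (\<lambda>t. dist (y + t *\<^sub>R d) y < \<epsilon>) (at_right 0)"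
      using \<epsilon>(1) by (auto dest: tendstoD)
    with dec feasible_eventually_interior[where h = h, OF h x feas d, simplified]
    have "eventually (\<lambda>t::real. False) (at_right 0)"
    proof eventually_elim
      case (elim t)
      then have "y + t *\<^sub>R d \<in> feasible k h x \<inter> ball y \<epsilon>"
        by (auto simp: feasible_def dist_commute less_imp_le)
      then show ?case using \<epsilon>(2) elim by fastforce
    qed
    then show False by simp
  qed
  have nonneg: "?G \<bullet> d \<ge> 0" if d: "\<And>i. i \<in> ?A \<Longrightarrow> ?v i \<bullet> d \<le> 0" for d
  proof (rule ccontr)
    assume neg: "\<not> ?G \<bullet> d \<ge> 0"
    \<comment> \<open>With this step, tilting by \<open>e\<close> gives back at most half of the
      descent \<open>?G \<bullet> d\<close>; the 1 in the denominator avoids division by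
      zero.\<close>
    define s where "s = - (?G \<bullet> d) / (2 * (\<bar>?G \<bullet> e\<bar> + 1))"
    have s: "s > 0" unfolding s_def using neg by (intro divide_pos_pos) auto
    have "s * (?G \<bullet> e) \<le> s * (\<bar>?G \<bullet> e\<bar> + 1)" using s by (intro mult_left_mono) auto
    also have "\<dots> = - (?G \<bullet> d) / 2" unfolding s_def by (simp add: field_simps)
    finally have "?G \<bullet> (d + s *\<^sub>R e) < 0" using neg by (simp add: inner_add_right)
    moreover have "?v i \<bullet> (d + s *\<^sub>R e) < 0" if "i \<in> ?A" for i
      using d[OF that] e[OF that] s by (simp add: inner_add_right)
    ultimately show False using no_descent by blast
  qed
  obtain p q where pq: "p \<in> span (?v ` ?A)" "\<And>w. w \<in> span (?v ` ?A) \<Longrightarrow> q \<bullet> w = 0" "?G = p + q"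
    using orthogonal_subspace_decomp_exists[of "?v ` ?A" ?G] unfolding orthogonal_def by metis
  have "?v i \<bullet> q = 0" if "i \<in> ?A" for i
    using pq(2)[OF span_base[OF imageI[OF that]]] by (simp add: inner_commute)
  \<comment> \<open>Since \<open>- q\<close> is orthogonal to the active gradients, it lies in the
    cone; the value there is -|q|^2, which forces \<open>q = 0\<close>.\<close>
  then have "?G \<bullet> (- q) \<ge> 0" by (intro nonneg) simp
  moreover have "?G \<bullet> q = q \<bullet> q"
    using pq(2)[OF pq(1)] by (simp add: pq(3) inner_add_left inner_add_right inner_commute)
  ultimately have "q = 0"
    by (metis inner_ge_zero inner_minus_right inner_eq_zero_iff neg_0_le_iff_le order_antisym)
  then obtain c where c: "?G = (\<Sum>i\<in>?A. c i *\<^sub>R ?v i)"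
    using span_image_finite[OF fin ind(1) pq(1)] pq(3) by (metis add.right_neutral)
  define l where "l = (\<lambda>i. if i \<in> ?A then - c i else 0)"
  have "l i \<ge> 0" if i: "i \<in> ?A" for i
  proof -
    \<comment> \<open>The direction \<open>- u i\<close> lowers constraint i to first order and
      leaves the other active ones unchanged.\<close>
    have "?G \<bullet> (- u i) \<ge> 0"
      using u[OF i] by (intro nonneg) (simp add: inner_commute)
    moreover have "u i \<bullet> ?G = c i"
      using i fin unfolding c by (simp add: inner_sum_right u if_distrib cong: if_cong)
    ultimately show ?thesis using i by (simp add: l_def inner_commute)
  qed
  moreover have "(\<Sum>i=1..k. l i *\<^sub>R ?v i) = (\<Sum>i\<in>?A. l i *\<^sub>R ?v i)"
    by (rule sum.mono_neutral_right) (auto simp: l_def active_set_def)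
  then have "?G + (\<Sum>i=1..k. l i *\<^sub>R ?v i) = 0"
    by (simp add: c l_def sum_negf)
  ultimately have "KKT_pair g k h x y l"
    using feas unfolding KKT_pair_def by (auto simp: l_def feasible_def active_set_def)
  then show thesis by (rule that)
qed

section \<open>From failing neighbourhoods to sequences\<close>

lemma LIMSEQ_dist_less_inverse:
  assumes "\<And>n. dist (zs n) y < inverse (real (Suc n))"
  shows "zs \<longlonglongrightarrow> y"
proof (rule tendsto_dist_iff[THEN iffD2], rule real_tendsto_sandwich[OF _ _ tendsto_const LIMSEQ_inverse_real_of_nat])
  show "eventually (\<lambda>n. 0 \<le> dist (zs n) y) sequentially" by simp
  show "eventually (\<lambda>n. dist (zs n) y \<le> inverse (real (Suc n))) sequentially"
    by (rule always_eventually, rule allI, rule less_imp_le, rule assms)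
qed

lemma not_eventually_nhds_sequence:
  fixes x :: "'a::metric_space"
  assumes "\<not> eventually P (nhds x)"
  shows "\<exists>xs. xs \<longlonglongrightarrow> x \<and> (\<forall>n::nat. \<not> P (xs n))"
proof -
  have "\<exists>x'. dist x' x < inverse (real (Suc n)) \<and> \<not> P x'" for n
    using assms unfolding eventually_nhds_metric
    by (metis inverse_positive_iff_positive of_nat_0_less_iff zero_less_Suc)
  then obtain xs where xs: "\<And>n. dist (xs n) x < inverse (real (Suc n))" "\<And>n. \<not> P (xs n)" by metis
  then show ?thesis using LIMSEQ_dist_less_inverse[of xs x] by blast
qed

section \<open>Limits of minimizers\<close>

locale parametric_program =
  fixes X :: "'a::metric_space set" and g :: "'a \<Rightarrow> real^'m \<Rightarrow> real"
    and k :: nat and h :: "nat \<Rightarrow> 'a \<Rightarrow> real^'m \<Rightarrow> real"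
  assumes C2_g: "C2_family X g" and C2_h: "i \<in> {1..k} \<Longrightarrow> C2_family X (h i)"
    and bounded_feasible: "uniformly_bounded X (feasible k h)"
    and licq: "x \<in> X \<Longrightarrow> LICQ k h x" and scsc: "x \<in> X \<Longrightarrow> SCSC g k h x"
    and sosc: "uniform_SOSC X g k h"
begin

abbreviation "minimizer \<equiv> local_minimizer g k h"
abbreviation "KKT \<equiv> KKT_pair g k h"
abbreviation "active \<equiv> active_set k h"

lemma finite_active: "finite (active x y)"
  by (simp add: active_set_def)

lemma minimizer_feasible: "minimizer x y \<Longrightarrow> y \<in> feasible k h x"
  by (simp add: local_minimizer_def)

lemma KKT_feasible: "KKT x y l \<Longrightarrow> y \<in> feasible k h x"
  by (simp add: KKT_pair_def feasible_def)

lemma minimizer_KKT: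
  assumes "x \<in> X" "minimizer x y"
  obtains l where "KKT x y l"
  using KKT_necessary[OF C2_g C2_h assms(1) licq[OF assms(1)] assms(2)] by metis

section \<open>Derivatives of the Lagrangian\<close>

lemma lagrangian_GDERIV:
  assumes x: "x \<in> X"
  shows "GDERIV (lagrangian g k h x l) y :> grad (g x) y + (\<Sum>i=1..k. l i *\<^sub>R grad (h i x) y)"
proof -
  have "(lagrangian g k h x l has_derivative
      (\<lambda>d. d \<bullet> grad (g x) y + (\<Sum>i=1..k. l i * (d \<bullet> grad (h i x) y)))) (at y)"
    unfolding lagrangian_def[abs_def]
    using C2_family_GDERIV[OF C2_g x] C2_family_GDERIV[OF C2_h x]
    by (intro has_derivative_add has_derivative_sum has_derivative_mult_right)
      (auto simp: gderiv_def)
  then show ?thesis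
    by (simp add: gderiv_def inner_add_right inner_sum_right)
qed

lemmas grad_lagrangian = lagrangian_GDERIV[THEN grad_eqI]

lemma lagrangian_grad_derivative:
  assumes x: "x \<in> X"
  shows "(grad (lagrangian g k h x l) has_derivative
    (*v) (hessian (g x) y + (\<Sum>i=1..k. l i *\<^sub>R hessian (h i x) y))) (at y)"
proof -
  have "grad (lagrangian g k h x l) = (\<lambda>y. grad (g x) y + (\<Sum>i=1..k. l i *\<^sub>R grad (h i x) y))"
    using grad_lagrangian[OF x] by blast
  moreover have "((\<lambda>y. grad (g x) y + (\<Sum>i=1..k. l i *\<^sub>R grad (h i x) y)) has_derivative
      (\<lambda>d. hessian (g x) y *v d + (\<Sum>i=1..k. l i *\<^sub>R (hessian (h i x) y *v d)))) (at y)"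
    using C2_family_grad_derivative[OF C2_g x] C2_family_grad_derivative[OF C2_h x]
    by (intro has_derivative_add has_derivative_sum has_derivative_scaleR_right) auto
  moreover have "(*v) (hessian (g x) y + (\<Sum>i=1..k. l i *\<^sub>R hessian (h i x) y))
      = (\<lambda>d. hessian (g x) y *v d + (\<Sum>i=1..k. l i *\<^sub>R (hessian (h i x) y *v d)))"
    by (rule ext) (simp add: matrix_vector_mult_add_rdistrib matrix_vector_mult_sum)
  ultimately show ?thesis by simp
qed

lemma hessian_lagrangian:
  assumes x: "x \<in> X"
  shows "hessian (lagrangian g k h x l) y = hessian (g x) y + (\<Sum>i=1..k. l i *\<^sub>R hessian (h i x) y)"
  using hessian_eqI[OF lagrangian_grad_derivative[OF x]] by simp

lemma hessian_lagrangian_tendsto: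
  assumes x: "x \<in> X" "(xs \<longlongrightarrow> x) F" "\<And>n. xs n \<in> X" and y: "(ys \<longlongrightarrow> y) F"
    and l: "\<And>i. i \<in> {1..k} \<Longrightarrow> ((\<lambda>n. ls n i) \<longlongrightarrow> l i) F"
  shows "((\<lambda>n. hessian (lagrangian g k h (xs n) (ls n)) (ys n))
    \<longlongrightarrow> hessian (lagrangian g k h x l) y) F"
  unfolding hessian_lagrangian[OF x(1)] hessian_lagrangian[OF x(3)]
  using x by (intro tendsto_add tendsto_sum tendsto_scaleR l C2_family_tendsto(3)[OF C2_g _ _ _ y]
      C2_family_tendsto(3)[OF C2_h _ _ _ y]) auto

text \<open>At a KKT pair with strict complementarity the critical cone is the tangent space of the
  active constraints, so this is the pointwise second-order sufficient condition. It gets its own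
  name because it is needed at limit points not yet known to be minimizers.\<close>

definition positive_on_tangents :: "'a \<Rightarrow> real^'m \<Rightarrow> (nat \<Rightarrow> real) \<Rightarrow> bool" where
  "positive_on_tangents x y l \<longleftrightarrow>
     (\<forall>d. d \<noteq> 0 \<longrightarrow> (\<forall>i\<in>active x y. grad (h i x) y \<bullet> d = 0) \<longrightarrow>
        d \<bullet> (hessian (lagrangian g k h x l) y *v d) > 0)"

lemma limit_feasible:
  assumes x: "x \<in> X" "xs \<longlonglongrightarrow> x" "\<And>n. xs n \<in> X" and y: "ys \<longlonglongrightarrow> y"
    and feas: "\<And>n. ys n \<in> feasible k h (xs n)"
  shows "y \<in> feasible k h x"
proof -
  have "h i x y \<le> 0" if i: "i \<in> {1..k}" for i
  proof (rule LIMSEQ_le_const2)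
    show "(\<lambda>n. h i (xs n) (ys n)) \<longlonglongrightarrow> h i x y"
      using x y by (intro C2_family_tendsto(1)[OF C2_h[OF i]]) auto
  qed (use feas i in \<open>auto simp: feasible_def\<close>)
  then show ?thesis by (simp add: feasible_def)
qed

text \<open>Constraints inactive at \<open>y\<close> carry zero multipliers for large
  \<open>n\<close>. Stationarity thus becomes a combination of gradients that tend to an independent
  family, and its coefficients converge. Tangent vectors at \<open>y\<close> are limits of tangent
  vectors at \<open>ys n\<close>, where SOSC is available.\<close>

lemma minimizers_limit:
  assumes x: "x \<in> X" "xs \<longlonglongrightarrow> x" "\<And>n. xs n \<in> X"
    and y: "ys \<longlonglongrightarrow> y" "\<And>n. minimizer (xs n) (ys n)"
  shows "\<exists>ls l. (\<forall>n. KKT (xs n) (ys n) (ls n)) \<and> KKT x y l \<and>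
    (\<forall>i\<in>{1..k}. (\<lambda>n. ls n i) \<longlonglongrightarrow> l i) \<and>
    eventually (\<lambda>n. active (xs n) (ys n) = active x y) sequentially \<and>
    positive_on_tangents x y l"
proof -
  let ?A = "active x y" and ?v = "\<lambda>i. grad (h i x) y" and ?w = "\<lambda>n i. grad (h i (xs n)) (ys n)"
  have feas: "y \<in> feasible k h x"
    using limit_feasible[OF x y(1)] minimizer_feasible[OF y(2)] by blast
  have ind: "inj_on ?v ?A" "independent (?v ` ?A)"
    using licq[OF x(1)] feas by (auto simp: LICQ_def)
  have hlim: "(\<lambda>n. h i (xs n) (ys n)) \<longlonglongrightarrow> h i x y" if i: "i \<in> {1..k}" for i
    using x y by (intro C2_family_tendsto(1)[OF C2_h[OF i]]) auto
  have wlim: "(\<lambda>n. ?w n i) \<longlonglongrightarrow> ?v i" if i: "i \<in> {1..k}" for i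
    using x y by (intro C2_family_tendsto(2)[OF C2_h[OF i]]) auto
  have glim: "(\<lambda>n. grad (g (xs n)) (ys n)) \<longlonglongrightarrow> grad (g x) y"
    using x y by (intro C2_family_tendsto(2)[OF C2_g]) auto
  have Ak: "?A \<subseteq> {1..k}" by (auto simp: active_set_def)
  have "\<forall>n. \<exists>l. KKT (xs n) (ys n) l"
    using minimizer_KKT[OF x(3) y(2)] by metis
  then obtain ls where ls: "\<And>n. KKT (xs n) (ys n) (ls n)" by metis
  have inactive: "eventually (\<lambda>n. \<forall>i\<in>{1..k} - ?A. h i (xs n) (ys n) < 0) sequentially"
  proof (rule eventually_ball_finite, simp, rule ballI)
    fix i assume "i \<in> {1..k} - ?A"
    then have "h i x y < 0" "i \<in> {1..k}" using feas by (force simp: active_set_def feasible_def)+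
    then show "eventually (\<lambda>n. h i (xs n) (ys n) < 0) sequentially"
      using order_tendstoD(2)[OF hlim] by blast
  qed
  \<comment> \<open>Complementarity at \<open>ys n\<close>.\<close>
  then have ls0: "eventually (\<lambda>n. \<forall>i\<in>{1..k} - ?A. ls n i = 0) sequentially"
  proof eventually_elim
    case (elim n)
    then show ?case using ls[of n] by (force simp: KKT_pair_def)
  qed
  have stat: "grad (g (xs n)) (ys n) + (\<Sum>i=1..k. ls n i *\<^sub>R ?w n i) = 0" for n
    using ls[of n] by (simp add: KKT_pair_def)
  have lin: "(\<lambda>n. \<Sum>i\<in>?A. ls n i *\<^sub>R ?w n i) \<longlonglongrightarrow> - grad (g x) y"
  proof (rule Lim_transform_eventually[OF tendsto_minus[OF glim]])
    show "eventually (\<lambda>n. - grad (g (xs n)) (ys n) = (\<Sum>i\<in>?A. ls n i *\<^sub>R ?w n i)) sequentially"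
      using ls0
    proof eventually_elim
      case (elim n)
      have "(\<Sum>i\<in>?A. ls n i *\<^sub>R ?w n i) = (\<Sum>i=1..k. ls n i *\<^sub>R ?w n i)"
        by (rule sum.mono_neutral_left) (use Ak elim in auto)
      then show ?case using stat[of n] by (simp add: neg_eq_iff_add_eq_0)
    qed
  qed
  have wA: "\<And>i. i \<in> ?A \<Longrightarrow> (\<lambda>n. ?w n i) \<longlonglongrightarrow> ?v i" using wlim Ak by blast
  have "\<exists>c. \<forall>i\<in>?A. (\<lambda>n. ls n i) \<longlonglongrightarrow> c i"
    by (rule coefficients_converge[OF finite_active ind wA lin])
  then obtain c where c: "\<forall>i\<in>?A. (\<lambda>n. ls n i) \<longlonglongrightarrow> c i" by (elim exE)
  define l where "l = (\<lambda>i. if i \<in> ?A then c i else 0)"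
  have llim: "(\<lambda>n. ls n i) \<longlonglongrightarrow> l i" if i: "i \<in> {1..k}" for i
  proof (cases "i \<in> ?A")
    case True
    then show ?thesis using c by (simp add: l_def)
  next
    case False
    have "eventually (\<lambda>n. ls n i = 0) sequentially"
      using ls0 by eventually_elim (use i False in auto)
    then show ?thesis using False by (simp add: l_def tendsto_eventually)
  qed
  have kkt: "KKT x y l"
    unfolding KKT_pair_def
  proof (intro conjI ballI)
    have "(\<lambda>n. grad (g (xs n)) (ys n) + (\<Sum>i=1..k. ls n i *\<^sub>R ?w n i))
        \<longlonglongrightarrow> grad (g x) y + (\<Sum>i=1..k. l i *\<^sub>R ?v i)"
      by (intro tendsto_add tendsto_sum tendsto_scaleR glim llim wlim) auto
    then show "grad (g x) y + (\<Sum>i=1..k. l i *\<^sub>R ?v i) = 0"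
      unfolding stat by (simp add: LIMSEQ_const_iff)
  next
    fix i assume i: "i \<in> {1..k}"
    show "h i x y \<le> 0" using feas i by (simp add: feasible_def)
    show "0 \<le> l i"
      using ls i by (intro LIMSEQ_le_const[OF llim[OF i]]) (auto simp: KKT_pair_def)
    show "l i * h i x y = 0" by (auto simp: l_def active_set_def)
  qed
  \<comment> \<open>SCSC is applied to the limit pair. Positive limits make \<open>ls n i\<close>
    positive eventually, and complementarity then keeps constraint i active at
    \<open>ys n\<close>.\<close>
  have lpos: "l i > 0" if "i \<in> ?A" for i
    using scsc[OF x(1)] kkt that unfolding SCSC_def by (force simp: active_set_def)
  have "eventually (\<lambda>n. \<forall>i\<in>?A. ls n i > 0) sequentially"
    using Ak lpos order_tendstoD(1)[OF llim] by (intro eventually_ball_finite finite_active) blast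
  with inactive have act: "eventually (\<lambda>n. active (xs n) (ys n) = ?A) sequentially"
  proof eventually_elim
    case (elim n)
    have "h i (xs n) (ys n) = 0" if "i \<in> ?A" for i
    proof -
      have "ls n i > 0" "i \<in> {1..k}" using elim that Ak by auto
      then show ?thesis using ls[of n] by (force simp: KKT_pair_def)
    qed
    then show ?case using elim(1) Ak by (force simp: active_set_def)
  qed
  obtain \<sigma> where \<sigma>: "\<sigma> > 0" "\<And>x y l d. x \<in> X \<Longrightarrow> minimizer x y \<Longrightarrow> KKT x y l \<Longrightarrow>
      d \<in> critical_cone k h x y l \<Longrightarrow>
      \<sigma> * (norm d)\<^sup>2 \<le> d \<bullet> (hessian (lagrangian g k h x l) y *v d)"
    using sosc unfolding uniform_SOSC_def by blast
  have pos: "positive_on_tangents x y l"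
    unfolding positive_on_tangents_def
  proof (intro allI impI)
    fix d :: "real^'m" assume d: "d \<noteq> 0" "\<forall>i\<in>?A. ?v i \<bullet> d = 0"
    have "\<exists>e. e \<longlonglongrightarrow> d \<and> (\<forall>n. \<forall>i\<in>?A. ?w n i \<bullet> e n = 0)"
      by (rule approximate_orthogonal[OF finite_active ind wA d(2)[rule_format]])
    then obtain e where e: "e \<longlonglongrightarrow> d" "\<And>n i. i \<in> ?A \<Longrightarrow> ?w n i \<bullet> e n = 0"
      by blast
    have "\<sigma> * (norm d)\<^sup>2 \<le> d \<bullet> (hessian (lagrangian g k h x l) y *v d)"
    proof (rule tendsto_le[OF sequentially_bot])
      show "(\<lambda>n. e n \<bullet> (hessian (lagrangian g k h (xs n) (ls n)) (ys n) *v e n))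
          \<longlonglongrightarrow> d \<bullet> (hessian (lagrangian g k h x l) y *v d)"
        using x by (intro tendsto_inner tendsto_matrix_vector_mult hessian_lagrangian_tendsto e y llim) auto
      show "(\<lambda>n. \<sigma> * (norm (e n))\<^sup>2) \<longlonglongrightarrow> \<sigma> * (norm d)\<^sup>2"
        by (intro tendsto_intros e)
      show "eventually (\<lambda>n. \<sigma> * (norm (e n))\<^sup>2
          \<le> e n \<bullet> (hessian (lagrangian g k h (xs n) (ls n)) (ys n) *v e n)) sequentially"
        using act
      proof eventually_elim
        case (elim n)
        \<comment> \<open>On the active set all products vanish, which meets both clauses of the
          cone whatever the multipliers are.\<close>
        then have "e n \<in> critical_cone k h (xs n) (ys n) (ls n)"
          using e(2) by (simp add: critical_cone_def)
        then show ?case using \<sigma>(2)[OF x(3) y(2) ls] by blast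
      qed
    qed
    moreover have "\<sigma> * (norm d)\<^sup>2 > 0" using \<sigma>(1) d(1) by simp
    ultimately show "0 < d \<bullet> (hessian (lagrangian g k h x l) y *v d)" by linarith
  qed
  show ?thesis
    by (intro exI[of _ ls] exI[of _ l] conjI allI ballI ls kkt llim act pos)
qed

text \<open>To first order, \<open>d\<close> increases neither the objective nor any active
  constraint, and stationarity with positive multipliers then makes it tangent. To second order, the
  Taylor expansion of the Lagrangian at \<open>ys n\<close>, where its gradient vanishes, makes its
  quadratic form nonpositive on \<open>d\<close>, against positivity on tangents.\<close>

lemma KKT_no_minimizing_direction:
  assumes x: "x \<in> X" "xs \<longlonglongrightarrow> x" "\<And>n. xs n \<in> X"
    and y: "ys \<longlonglongrightarrow> y" "\<And>n. KKT (xs n) (ys n) (ls n)"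
    and l: "\<And>i. i \<in> {1..k} \<Longrightarrow> (\<lambda>n. ls n i) \<longlonglongrightarrow> l i"
    and kkt: "KKT x y l" and pos: "positive_on_tangents x y l"
    and z: "zs \<longlonglongrightarrow> y" "\<And>n. zs n \<in> feasible k h (xs n)" "\<And>n. g (xs n) (zs n) \<le> g (xs n) (ys n)"
    and d: "(\<lambda>n. (zs n - ys n) /\<^sub>R norm (zs n - ys n)) \<longlonglongrightarrow> d" and d1: "norm d = 1"
  shows False
proof -
  let ?A = "active x y" and ?v = "\<lambda>i. grad (h i x) y"
  let ?d = "\<lambda>n. (zs n - ys n) /\<^sub>R norm (zs n - ys n)"
  have lpos: "l i > 0" if "i \<in> ?A" for i
    using scsc[OF x(1)] kkt that unfolding SCSC_def by (force simp: active_set_def)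
  have Ak: "?A \<subseteq> {1..k}" by (auto simp: active_set_def)
  have hd: "?v i \<bullet> d \<le> 0" if i: "i \<in> ?A" for i
  proof (rule tendsto_upperbound)
    have ik: "i \<in> {1..k}" using i Ak by blast
    show "(\<lambda>n. (h i (xs n) (zs n) - h i (xs n) (ys n)) / norm (zs n - ys n)) \<longlonglongrightarrow> ?v i \<bullet> d"
      by (rule C2_family_difference_quotient[OF C2_h[OF ik] x y(1) z(1) d])
    \<comment> \<open>A positive multiplier makes constraint i active at \<open>ys n\<close>, so the
      quotient has the sign of its value at the feasible point \<open>zs n\<close>.\<close>
    have "eventually (\<lambda>n. ls n i > 0) sequentially"
      using order_tendstoD(1)[OF l[OF ik] lpos[OF i]] .
    then show "eventually (\<lambda>n. (h i (xs n) (zs n) - h i (xs n) (ys n)) / norm (zs n - ys n) \<le> 0) sequentially"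
    proof eventually_elim
      case (elim n)
      then have "h i (xs n) (ys n) = 0" using y(2)[of n] ik by (force simp: KKT_pair_def)
      then show ?case using z(2)[of n] ik by (simp add: feasible_def divide_le_0_iff)
    qed
  qed simp
  have gd: "grad (g x) y \<bullet> d \<le> 0"
  proof (rule tendsto_upperbound)
    show "(\<lambda>n. (g (xs n) (zs n) - g (xs n) (ys n)) / norm (zs n - ys n)) \<longlonglongrightarrow> grad (g x) y \<bullet> d"
      by (rule C2_family_difference_quotient[OF C2_g x y(1) z(1) d])
  qed (use z(3) in \<open>auto simp: divide_le_0_iff\<close>)
  have l0: "l i = 0" if "i \<in> {1..k} - ?A" for i
    using kkt that by (auto simp: KKT_pair_def active_set_def)
  have "(grad (g x) y + (\<Sum>i=1..k. l i *\<^sub>R ?v i)) \<bullet> d = 0"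
    using kkt by (simp add: KKT_pair_def)
  then have "grad (g x) y \<bullet> d + (\<Sum>i=1..k. l i * (?v i \<bullet> d)) = 0"
    by (simp add: inner_add_left inner_sum_left)
  moreover have "(\<Sum>i=1..k. l i * (?v i \<bullet> d)) = (\<Sum>i\<in>?A. l i * (?v i \<bullet> d))"
    by (rule sum.mono_neutral_right) (use Ak l0 in auto)
  moreover have le0: "l i * (?v i \<bullet> d) \<le> 0" if "i \<in> ?A" for i
    using lpos[OF that] hd[OF that] by (simp add: mult_le_0_iff)
  moreover have "(\<Sum>i\<in>?A. l i * (?v i \<bullet> d)) \<le> 0"
    using le0 by (rule sum_nonpos)
  \<comment> \<open>Each summand is nonpositive, and by stationarity and \<open>gd\<close> their sum
    is nonnegative.\<close>
  ultimately have "(\<Sum>i\<in>?A. - (l i * (?v i \<bullet> d))) = 0"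
    using gd by (simp add: sum_negf)
  then have "\<forall>i\<in>?A. - (l i * (?v i \<bullet> d)) = 0"
    using le0 by (subst (asm) sum_nonneg_eq_0_iff) (auto simp: finite_active)
  then have tangent: "\<forall>i\<in>?A. ?v i \<bullet> d = 0" using lpos by fastforce
  let ?L = "\<lambda>n. lagrangian g k h (xs n) (ls n)"
  have Lg: "GDERIV (?L n) y :> grad (?L n) y" for n y
    using lagrangian_GDERIV[OF x(3)] by (simp add: grad_lagrangian[OF x(3)])
  have Lh: "(grad (?L n) has_derivative (*v) (hessian (?L n) y)) (at y)" for n y
    using lagrangian_grad_derivative[OF x(3)] by (simp add: hessian_lagrangian[OF x(3)])
  have "\<forall>n. \<exists>t. 0 < t \<and> t < 1 \<and> ?L n (zs n) - ?L n (ys n) = grad (?L n) (ys n) \<bullet> (zs n - ys n)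
      + (zs n - ys n) \<bullet> (hessian (?L n) (ys n + t *\<^sub>R (zs n - ys n)) *v (zs n - ys n)) / 2"
    using segment_taylor2[OF Lg Lh] by blast
  from choice[OF this] obtain t where t: "\<And>n. 0 < t n" "\<And>n. t n < 1"
    "\<And>n. ?L n (zs n) - ?L n (ys n) = grad (?L n) (ys n) \<bullet> (zs n - ys n)
      + (zs n - ys n) \<bullet> (hessian (?L n) (ys n + t n *\<^sub>R (zs n - ys n)) *v (zs n - ys n)) / 2"
    by blast
  let ?H = "\<lambda>n. hessian (?L n) (ys n + t n *\<^sub>R (zs n - ys n))"
  \<comment> \<open>In terms of Lagrangian and objective: L(zs n) \<le> g(zs n) \<le> g(ys n) = L(ys
    n), by the signs of the multipliers and complementarity.\<close>
  have "?d n \<bullet> (?H n *v ?d n) \<le> 0" for n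
  proof -
    have lh: "ls n i * h i (xs n) (ys n) = 0" "ls n i \<ge> 0" if "i \<in> {1..k}" for i
      using y(2)[of n] that by (auto simp: KKT_pair_def)
    have "(\<Sum>i=1..k. ls n i * h i (xs n) (ys n)) = 0"
      using lh(1) by (rule sum.neutral[rule_format])
    then have "?L n (ys n) = g (xs n) (ys n)" by (simp add: lagrangian_def)
    moreover have "(\<Sum>i=1..k. ls n i * h i (xs n) (zs n)) \<le> 0"
      using lh z(2)[of n] by (intro sum_nonpos) (simp add: feasible_def mult_le_0_iff)
    then have "?L n (zs n) \<le> g (xs n) (zs n)" by (simp add: lagrangian_def)
    moreover have "grad (?L n) (ys n) = 0"
      using y(2)[of n] by (simp add: grad_lagrangian[OF x(3)] KKT_pair_def)
    ultimately have "(zs n - ys n) \<bullet> (?H n *v (zs n - ys n)) \<le> 0"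
      using t(3)[of n] z(3)[of n] by simp
    then show ?thesis
      by (simp add: matrix_vector_mult_scaleR mult_nonneg_nonpos flip: mult.assoc)
  qed
  moreover have "(\<lambda>n. ?d n \<bullet> (?H n *v ?d n)) \<longlonglongrightarrow> d \<bullet> (hessian (lagrangian g k h x l) y *v d)"
    using x by (intro tendsto_inner tendsto_matrix_vector_mult hessian_lagrangian_tendsto d l
        segment_point_tendsto y z t) auto
  ultimately have "d \<bullet> (hessian (lagrangian g k h x l) y *v d) \<le> 0"
    by (intro LIMSEQ_le_const2) auto
  moreover have d0: "d \<noteq> 0" using d1 by auto
  then have "d \<bullet> (hessian (lagrangian g k h x l) y *v d) > 0"
    using pos tangent d0 unfolding positive_on_tangents_def by blast
  ultimately show False by linarith
qed

text \<open>Otherwise the normalized differences would lie on the compact unit sphere and a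
  subsequence would yield the excluded direction. A single coincidence suffices as conclusion, since
  the lemma is applied to sequences whose terms all differ.\<close>

lemma KKT_local_uniqueness:
  assumes x: "x \<in> X" "xs \<longlonglongrightarrow> x" "\<And>n. xs n \<in> X"
    and y: "ys \<longlonglongrightarrow> y" "\<And>n. KKT (xs n) (ys n) (ls n)"
    and l: "\<And>i. i \<in> {1..k} \<Longrightarrow> (\<lambda>n. ls n i) \<longlonglongrightarrow> l i"
    and kkt: "KKT x y l" and pos: "positive_on_tangents x y l"
    and z: "zs \<longlonglongrightarrow> y" "\<And>n. zs n \<in> feasible k h (xs n)" "\<And>n. g (xs n) (zs n) \<le> g (xs n) (ys n)"
  shows "\<exists>n. zs n = ys n"
proof (rule ccontr)
  assume "\<not> (\<exists>n. zs n = ys n)"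
  then have ne: "\<And>n. zs n \<noteq> ys n" by blast
  have "\<forall>n. (zs n - ys n) /\<^sub>R norm (zs n - ys n) \<in> sphere 0 1"
    using ne by simp
  then obtain d r where d: "d \<in> sphere 0 1" and r: "strict_mono r"
    and lim: "((\<lambda>n. (zs n - ys n) /\<^sub>R norm (zs n - ys n)) \<circ> r) \<longlonglongrightarrow> d"
    by (rule seq_compactE[OF compact_imp_seq_compact[OF compact_sphere]])
  show False
  proof (rule KKT_no_minimizing_direction[where xs = "xs \<circ> r" and ys = "ys \<circ> r" and zs = "zs \<circ> r"
        and ls = "ls \<circ> r" and d = d, OF x(1) _ _ _ _ _ kkt pos])
    show "(xs \<circ> r) \<longlonglongrightarrow> x" "(ys \<circ> r) \<longlonglongrightarrow> y" "(zs \<circ> r) \<longlonglongrightarrow> y"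
      by (rule LIMSEQ_subseq_LIMSEQ[OF _ r], rule x y z)+
    show "(\<lambda>n. (ls \<circ> r) n i) \<longlonglongrightarrow> l i" if "i \<in> {1..k}" for i
      using LIMSEQ_subseq_LIMSEQ[OF l[OF that] r] by (simp add: o_def)
    show "(\<lambda>n. ((zs \<circ> r) n - (ys \<circ> r) n) /\<^sub>R norm ((zs \<circ> r) n - (ys \<circ> r) n)) \<longlonglongrightarrow> d"
      using lim by (simp add: o_def)
    show "norm d = 1" using d by simp
  qed (simp_all add: x y z)
qed

lemma minimizer_strict:
  assumes x: "x \<in> X" and min: "minimizer x y"
  obtains \<epsilon> where "\<epsilon> > 0" "\<And>z. z \<in> feasible k h x \<Longrightarrow> dist z y < \<epsilon> \<Longrightarrow> g x z \<le> g x y \<Longrightarrow> z = y"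
proof -
  \<comment> \<open>Constant sequences turn the limit statement into one about \<open>y\<close>
    itself.\<close>
  obtain l where l: "KKT x y l" "positive_on_tangents x y l"
    using minimizers_limit[of x "\<lambda>_. x" "\<lambda>_. y" y] x min by auto
  have "\<exists>\<epsilon>>0. \<forall>z\<in>feasible k h x. dist z y < \<epsilon> \<longrightarrow> g x z \<le> g x y \<longrightarrow> z = y"
  proof (rule ccontr)
    assume "\<not> ?thesis"
    then have "\<exists>z\<in>feasible k h x. dist z y < inverse (real (Suc n)) \<and> g x z \<le> g x y \<and> z \<noteq> y" for n
      by (metis inverse_positive_iff_positive of_nat_0_less_iff zero_less_Suc)
    then obtain zs where zs: "\<And>n. zs n \<in> feasible k h x" "\<And>n. dist (zs n) y < inverse (real (Suc n))"
      "\<And>n. g x (zs n) \<le> g x y" "\<And>n. zs n \<noteq> y" by metis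
    have "zs \<longlonglongrightarrow> y"
      by (rule LIMSEQ_dist_less_inverse[OF zs(2)])
    then have "\<exists>n. zs n = y"
      using KKT_local_uniqueness[of x "\<lambda>_. x" "\<lambda>_. y" y "\<lambda>_. l" l zs] x l zs(1,3) by auto
    then show False using zs(4) by blast
  qed
  then show thesis using that by blast
qed

text \<open>Minimality is second-order sufficiency: better feasible points arbitrarily near
  \<open>y\<close> would contradict \<open>KKT_local_uniqueness\<close> with the constant base
  sequence \<open>y\<close>.\<close>

lemma limit_of_minimizers:
  assumes x: "x \<in> X" "xs \<longlonglongrightarrow> x" "\<And>n. xs n \<in> X"
    and y: "ys \<longlonglongrightarrow> y" "\<And>n. minimizer (xs n) (ys n)"
  shows "minimizer x y" "eventually (\<lambda>n. active (xs n) (ys n) = active x y) sequentially"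
proof -
  obtain l where ls: "KKT x y l" and pos: "positive_on_tangents x y l"
    and act: "eventually (\<lambda>n. active (xs n) (ys n) = active x y) sequentially"
    using minimizers_limit[OF x y] by blast
  show "eventually (\<lambda>n. active (xs n) (ys n) = active x y) sequentially" by (rule act)
  show "minimizer x y"
  proof (rule ccontr)
    assume not: "\<not> minimizer x y"
    have feas: "y \<in> feasible k h x" using ls by (rule KKT_feasible)
    have "\<exists>z\<in>feasible k h x. dist z y < inverse (real (Suc n)) \<and> g x z < g x y" for n
    proof (rule ccontr)
      assume "\<not> ?thesis"
      then have "minimizer x y"
        unfolding local_minimizer_def using feas
        by (intro conjI exI[of _ "inverse (real (Suc n))"]) (auto simp: dist_commute not_less)
      then show False using not by blast
    qed
    then obtain zs where zs: "\<And>n. zs n \<in> feasible k h x" "\<And>n. dist (zs n) y < inverse (real (Suc n))"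
      "\<And>n. g x (zs n) < g x y" by metis
    have "zs \<longlonglongrightarrow> y"
      by (rule LIMSEQ_dist_less_inverse[OF zs(2)])
    then have "\<exists>n. zs n = y"
      using KKT_local_uniqueness[of x "\<lambda>_. x" "\<lambda>_. y" y "\<lambda>_. l" l zs] x(1) ls pos zs(1)
        less_imp_le[OF zs(3)] by auto
    then show False using zs(3) by auto
  qed
qed

section \<open>Local constancy of the minimizer count\<close>

lemma feasible_subsequence:
  assumes "\<And>n. xs n \<in> X" "\<And>n. ys n \<in> feasible k h (xs n)"
  obtains y r where "strict_mono (r :: nat \<Rightarrow> nat)" "(ys \<circ> r) \<longlonglongrightarrow> y"
proof -
  obtain R where R: "\<And>x. x \<in> X \<Longrightarrow> feasible k h x \<subseteq> {y. norm y \<le> R}"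
    using bounded_feasible unfolding uniformly_bounded_def by blast
  have "\<forall>n. ys n \<in> cball 0 R" using R[OF assms(1)] assms(2) by auto
  then obtain y r where "y \<in> cball 0 R" "strict_mono (r :: nat \<Rightarrow> nat)" "(ys \<circ> r) \<longlonglongrightarrow> y"
    by (rule seq_compactE[OF compact_imp_seq_compact[OF compact_cball]])
  then show thesis using that by blast
qed

text \<open>Otherwise minimizers at parameters tending to \<open>x\<close> would stay away from
  every minimizer at \<open>x\<close> with the same active set, while a subsequence converges to
  one.\<close>

lemma eventually_minimizers_near:
  assumes x: "x \<in> X" and \<epsilon>: "\<epsilon> > 0"
  shows "eventually (\<lambda>x'. x' \<in> X \<longrightarrow> (\<forall>y'. minimizer x' y' \<longrightarrow>
    (\<exists>y. minimizer x y \<and> active x y = active x' y' \<and> dist y' y < \<epsilon>))) (nhds x)"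
proof (rule ccontr)
  assume "\<not> ?thesis"
  from not_eventually_nhds_sequence[OF this] obtain xs where xs: "xs \<longlonglongrightarrow> x" and
    not: "\<And>n. \<not> (xs n \<in> X \<longrightarrow> (\<forall>y'. minimizer (xs n) y' \<longrightarrow>
      (\<exists>y. minimizer x y \<and> active x y = active (xs n) y' \<and> dist y' y < \<epsilon>)))"
    by blast
  then obtain ys where ys: "\<And>n. xs n \<in> X" "\<And>n. minimizer (xs n) (ys n)"
    "\<And>n y. minimizer x y \<Longrightarrow> active x y = active (xs n) (ys n) \<Longrightarrow> \<not> dist (ys n) y < \<epsilon>"
    by metis
  obtain y r where r: "strict_mono r" and lim: "(ys \<circ> r) \<longlonglongrightarrow> y"
    by (rule feasible_subsequence[OF ys(1) minimizer_feasible[OF ys(2)]])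
  have min: "minimizer x y" and act: "eventually (\<lambda>n. active ((xs \<circ> r) n) ((ys \<circ> r) n) = active x y) sequentially"
    using limit_of_minimizers[of x "xs \<circ> r" "ys \<circ> r", OF x LIMSEQ_subseq_LIMSEQ[OF xs r] _ lim] ys
    by auto
  have "eventually (\<lambda>n. dist ((ys \<circ> r) n) y < \<epsilon>) sequentially"
    using lim \<epsilon> by (rule tendstoD)
  with act have "eventually (\<lambda>n. False) sequentially"
    by eventually_elim (use ys(3)[OF min] in auto)
  then show False by simp
qed

text \<open>The distance depends on \<open>x\<close> only; this uniformity in \<open>x'\<close> is
  what prevents two minimizers from merging at \<open>x\<close>.\<close>

lemma eventually_minimizers_separated:
  assumes x: "x \<in> X"
  obtains \<epsilon> where "\<epsilon> > 0" "eventually (\<lambda>x'. x' \<in> X \<longrightarrow>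
    (\<forall>y z. minimizer x' y \<longrightarrow> minimizer x' z \<longrightarrow> dist y z < \<epsilon> \<longrightarrow> y = z)) (nhds x)"
proof -
  have "\<exists>\<epsilon>>0. eventually (\<lambda>x'. x' \<in> X \<longrightarrow>
    (\<forall>y z. minimizer x' y \<longrightarrow> minimizer x' z \<longrightarrow> dist y z < \<epsilon> \<longrightarrow> y = z)) (nhds x)"
  proof (rule ccontr)
    assume not: "\<not> ?thesis"
    have "\<exists>x' y z. dist x' x < inverse (real (Suc n)) \<and> x' \<in> X \<and> minimizer x' y \<and> minimizer x' z \<and>
        dist z y < inverse (real (Suc n)) \<and> z \<noteq> y \<and> g x' z \<le> g x' y" for n
    proof -
      \<comment> \<open>One null sequence serves both as separation distance and as radius of the
        neighbourhood of \<open>x\<close>.\<close>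
      have pos: "inverse (real (Suc n)) > 0" by simp
      then have "\<not> eventually (\<lambda>x'. x' \<in> X \<longrightarrow> (\<forall>y z. minimizer x' y \<longrightarrow> minimizer x' z \<longrightarrow>
          dist y z < inverse (real (Suc n)) \<longrightarrow> y = z)) (nhds x)"
        using not by blast
      then obtain x' y z where *: "dist x' x < inverse (real (Suc n))" "x' \<in> X" "minimizer x' y"
        "minimizer x' z" "dist y z < inverse (real (Suc n))" "y \<noteq> z"
        using pos unfolding eventually_nhds_metric by blast
      \<comment> \<open>\<open>KKT_local_uniqueness\<close> is asymmetric, so of the two minimizers
        the one with the smaller objective is called \<open>z\<close>.\<close>
      show ?thesis
      proof (cases "g x' z \<le> g x' y")
        case True
        then show ?thesis using * by (metis dist_commute)
      next
        case False
        then have "g x' y \<le> g x' z" by simp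
        then show ?thesis using * by metis
      qed
    qed
    then obtain xs ys zs where xs: "\<And>n. dist (xs n) x < inverse (real (Suc n))" "\<And>n. xs n \<in> X"
      and ys: "\<And>n. minimizer (xs n) (ys n)" and zs: "\<And>n. minimizer (xs n) (zs n)"
      and d: "\<And>n. dist (zs n) (ys n) < inverse (real (Suc n))"
      and ne: "\<And>n. zs n \<noteq> ys n" and le: "\<And>n. g (xs n) (zs n) \<le> g (xs n) (ys n)"
      by metis
    obtain y r where r: "strict_mono r" and lim: "(ys \<circ> r) \<longlonglongrightarrow> y"
      by (rule feasible_subsequence[OF xs(2) minimizer_feasible[OF ys]])
    have "(\<lambda>n. zs n - ys n) \<longlonglongrightarrow> 0"
      using d by (intro LIMSEQ_dist_less_inverse) (simp add: dist_norm)
    from tendsto_add[OF lim LIMSEQ_subseq_LIMSEQ[OF this r]]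
    have zlim: "(zs \<circ> r) \<longlonglongrightarrow> y" by (simp add: o_def)
    have xlim: "(xs \<circ> r) \<longlonglongrightarrow> x"
      by (rule LIMSEQ_subseq_LIMSEQ[OF LIMSEQ_dist_less_inverse[OF xs(1)] r])
    obtain ls l where ls: "\<forall>n. KKT ((xs \<circ> r) n) ((ys \<circ> r) n) (ls n)" "KKT x y l"
      "\<forall>i\<in>{1..k}. (\<lambda>n. ls n i) \<longlonglongrightarrow> l i" "positive_on_tangents x y l"
      using minimizers_limit[of x "xs \<circ> r" "ys \<circ> r", OF x xlim _ lim] xs(2) ys by auto
    have "\<exists>n. (zs \<circ> r) n = (ys \<circ> r) n"
      by (rule KKT_local_uniqueness[OF x xlim _ lim _ _ ls(2) ls(4) zlim])
        (use xs(2) ls minimizer_feasible[OF zs] le in auto)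
    then show False using ne by auto
  qed
  then show thesis using that by blast
qed

section \<open>Persistence of a minimizer\<close>

lemma compact_feasible_cball:
  assumes x: "x \<in> X"
  shows "compact (feasible k h x \<inter> cball y \<rho>)"
proof -
  have "continuous_on UNIV (h i x)" if i: "i \<in> {1..k}" for i
    unfolding continuous_on_def
    using C2_family_tendsto(1)[OF C2_h[OF i] x tendsto_const _ tendsto_ident_at] x by auto
  then have "closed (\<Inter>i\<in>{1..k}. {y. h i x y \<le> 0})"
    by (intro closed_INT ballI closed_Collect_le continuous_on_const)
  moreover have "feasible k h x = (\<Inter>i\<in>{1..k}. {y. h i x y \<le> 0})"
    by (auto simp: feasible_def)
  ultimately show ?thesis by (metis closed_Int_compact compact_cball)
qed

lemma cball_constrained_minimum:
  assumes x: "x \<in> X" and ne: "feasible k h x \<inter> cball y \<rho> \<noteq> {}"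
  obtains w where "w \<in> feasible k h x \<inter> cball y \<rho>"
    "\<And>z. z \<in> feasible k h x \<inter> cball y \<rho> \<Longrightarrow> g x w \<le> g x z"
proof -
  have "continuous_on (feasible k h x \<inter> cball y \<rho>) (g x)"
    unfolding continuous_on_def
    using C2_family_tendsto(1)[OF C2_g x tendsto_const _ tendsto_ident_at] x by auto
  from continuous_attains_inf[OF compact_feasible_cball[OF x] ne this]
  show thesis using that by blast
qed

text \<open>A minimum over the feasible part of a closed ball is a local minimizer once it lies
  inside the open ball. A limit of such minima is no worse than \<open>y\<close>, hence equal to
  \<open>y\<close> by strictness. As \<open>y\<close> itself may be infeasible at nearby parameters,
  the comparison goes through the strictly feasible points \<open>p t\<close>.\<close>

lemma eventually_minimizer_persists:
  assumes x: "x \<in> X" and min: "minimizer x y" and \<epsilon>: "\<epsilon> > 0"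
  shows "eventually (\<lambda>x'. x' \<in> X \<longrightarrow>
    (\<exists>y'. minimizer x' y' \<and> active x' y' = active x y \<and> dist y' y < \<epsilon>)) (nhds x)"
proof (rule ccontr)
  assume "\<not> ?thesis"
  from not_eventually_nhds_sequence[OF this] obtain xs0 where xs0: "xs0 \<longlonglongrightarrow> x" and
    not: "\<And>n. \<not> (xs0 n \<in> X \<longrightarrow> (\<exists>y'. minimizer (xs0 n) y' \<and> active (xs0 n) y' = active x y \<and> dist y' y < \<epsilon>))"
    by blast
  obtain \<epsilon>' where \<epsilon>': "\<epsilon>' > 0"
    "\<And>z. z \<in> feasible k h x \<Longrightarrow> dist z y < \<epsilon>' \<Longrightarrow> g x z \<le> g x y \<Longrightarrow> z = y"
    using minimizer_strict[OF x min] by blast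
  \<comment> \<open>Halving puts the closed ball inside the open balls of radius
    \<open>\<epsilon>\<close> and \<open>\<epsilon>'\<close>.\<close>
  define \<rho> where "\<rho> = min \<epsilon> \<epsilon>' / 2"
  have \<rho>: "0 < \<rho>" "\<rho> < \<epsilon>" "\<rho> < \<epsilon>'" using \<epsilon> \<epsilon>' by (auto simp: \<rho>_def)
  have feas: "y \<in> feasible k h x" using min by (rule minimizer_feasible)
  obtain e where e: "\<And>i. i \<in> active x y \<Longrightarrow> grad (h i x) y \<bullet> e = - 1"
    using LICQ_interior_direction[OF licq[OF x] feas] by blast
  define p where "p = (\<lambda>t. y + t *\<^sub>R e)"
  have plim: "(p \<longlongrightarrow> y) (at_right 0)"
  proof -
    have "(p \<longlongrightarrow> y + 0 *\<^sub>R e) (at_right 0)" unfolding p_def by (intro tendsto_intros)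
    then show ?thesis by simp
  qed
  define interior where "interior = (\<lambda>z. (\<forall>i\<in>{1..k}. h i x z < 0) \<and> dist z y < \<rho>)"
  have "eventually (\<lambda>t. \<forall>i\<in>{1..k}. h i x (y + t *\<^sub>R e) < 0) (at_right 0)"
    by (rule feasible_eventually_interior[OF C2_h x feas]) (simp_all add: e)
  then have interior: "eventually (\<lambda>t. interior (p t)) (at_right 0)"
    using tendstoD[OF plim \<rho>(1)] unfolding interior_def p_def by eventually_elim auto
  have stays_feasible: "eventually (\<lambda>n. z \<in> feasible k h (us n) \<inter> cball y \<rho>) sequentially"
    if "interior z" "us \<longlonglongrightarrow> x" "\<And>n. us n \<in> X" for z us
  proof -
    have "eventually (\<lambda>n. \<forall>i\<in>{1..k}. h i (us n) z < 0) sequentially"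
    proof (rule eventually_ball_finite, simp, rule ballI)
      fix i assume i: "i \<in> {1..k}"
      have "(\<lambda>n. h i (us n) z) \<longlonglongrightarrow> h i x z"
        using that x by (intro C2_family_tendsto(1)[OF C2_h[OF i]]) auto
      then show "eventually (\<lambda>n. h i (us n) z < 0) sequentially"
        using that(1) i by (intro order_tendstoD(2)) (auto simp: interior_def)
    qed
    then show ?thesis
      by eventually_elim (use that(1) in \<open>auto simp: interior_def feasible_def dist_commute less_imp_le\<close>)
  qed
  have xs0X: "\<And>n. xs0 n \<in> X" using not by blast
  obtain t where "interior (p t)"
    using eventually_happens[OF interior] by (auto simp: trivial_limit_at_right_real)
  \<comment> \<open>The minimum over the ball exists only from \<open>N\<close> on, hence the shift
    by \<open>N\<close> below.\<close>
  then obtain N where N: "\<And>n. n \<ge> N \<Longrightarrow> feasible k h (xs0 n) \<inter> cball y \<rho> \<noteq> {}"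
    using stays_feasible[OF _ xs0 xs0X, of "p t"] unfolding eventually_sequentially by blast
  have "\<exists>w. w \<in> feasible k h (xs0 (n + N)) \<inter> cball y \<rho> \<and>
      (\<forall>z\<in>feasible k h (xs0 (n + N)) \<inter> cball y \<rho>. g (xs0 (n + N)) w \<le> g (xs0 (n + N)) z)" for n
    using cball_constrained_minimum[OF xs0X N, of "n + N"] by (metis le_add2)
  then obtain ys0 where ys0: "\<And>n. ys0 n \<in> feasible k h (xs0 (n + N)) \<inter> cball y \<rho>"
    "\<And>n z. z \<in> feasible k h (xs0 (n + N)) \<inter> cball y \<rho> \<Longrightarrow> g (xs0 (n + N)) (ys0 n) \<le> g (xs0 (n + N)) z"
    by metis
  obtain y' r where r: "strict_mono (r :: nat \<Rightarrow> nat)" and ylim: "(ys0 \<circ> r) \<longlonglongrightarrow> y'"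
    using feasible_subsequence[of "\<lambda>n. xs0 (n + N)" ys0] xs0X ys0(1) by blast
  define xs where "xs = (\<lambda>n. xs0 (r n + N))"
  define ys where "ys = (\<lambda>n. ys0 (r n))"
  have xs: "xs \<longlonglongrightarrow> x"
    using LIMSEQ_subseq_LIMSEQ[OF LIMSEQ_ignore_initial_segment[OF xs0, of N] r]
    by (simp add: xs_def o_def)
  have xsX: "\<And>n. xs n \<in> X" using xs0X by (simp add: xs_def)
  have ys: "\<And>n. ys n \<in> feasible k h (xs n)" "\<And>n. dist (ys n) y \<le> \<rho>"
    "\<And>n z. z \<in> feasible k h (xs n) \<inter> cball y \<rho> \<Longrightarrow> g (xs n) (ys n) \<le> g (xs n) z"
    using ys0 by (auto simp: xs_def ys_def dist_commute)
  have ylim: "ys \<longlonglongrightarrow> y'" using ylim by (simp add: ys_def o_def)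
  have y'feas: "y' \<in> feasible k h x" by (rule limit_feasible[OF x xs xsX ylim ys(1)])
  have y'dist: "dist y' y \<le> \<rho>"
    using ys(2) by (intro LIMSEQ_le_const2[OF tendsto_dist[OF ylim tendsto_const]]) auto
  \<comment> \<open>Here \<open>n\<close> tends to infinity with \<open>t\<close> fixed; only
    afterwards does \<open>t\<close> tend to 0.\<close>
  have "eventually (\<lambda>t. g x y' \<le> g x (p t)) (at_right 0)"
    using interior
  proof eventually_elim
    case (elim t)
    show ?case
    proof (rule tendsto_le[OF sequentially_bot])
      show "(\<lambda>n. g (xs n) (p t)) \<longlonglongrightarrow> g x (p t)" "(\<lambda>n. g (xs n) (ys n)) \<longlonglongrightarrow> g x y'"
        using x xs xsX ylim by (auto intro!: C2_family_tendsto(1)[OF C2_g])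
      show "eventually (\<lambda>n. g (xs n) (ys n) \<le> g (xs n) (p t)) sequentially"
        using stays_feasible[OF elim xs xsX] by eventually_elim (rule ys(3))
    qed
  qed
  moreover have "((\<lambda>t. g x (p t)) \<longlongrightarrow> g x y) (at_right 0)"
    using x plim by (intro C2_family_tendsto(1)[OF C2_g, of x "\<lambda>_. x"]) auto
  ultimately have "g x y' \<le> g x y"
    by (intro tendsto_lowerbound[where F = "at_right 0"]) (auto simp: trivial_limit_at_right_real)
  then have "y' = y" using \<epsilon>'(2)[OF y'feas] y'dist \<rho>(3) by simp
  then have ylim: "ys \<longlonglongrightarrow> y" using ylim by simp
  have "eventually (\<lambda>n. dist (ys n) y < \<rho>) sequentially" using ylim \<rho>(1) by (rule tendstoD)
  \<comment> \<open>From \<open>M\<close> on the ball is not binding: a smaller ball about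
    \<open>ys n\<close> fits inside it.\<close>
  then obtain M where M: "\<And>n. n \<ge> M \<Longrightarrow> dist (ys n) y < \<rho>" unfolding eventually_sequentially by blast
  have minM: "minimizer (xs (n + M)) (ys (n + M))" for n
  proof -
    have pos: "\<rho> - dist (ys (n + M)) y > 0" using M[of "n + M"] by simp
    have "z \<in> cball y \<rho>" if "z \<in> ball (ys (n + M)) (\<rho> - dist (ys (n + M)) y)" for z
      using that dist_triangle[of y z "ys (n + M)"] by (simp add: dist_commute)
    then show ?thesis
      unfolding local_minimizer_def using ys(1,3) pos by blast
  qed
  have "eventually (\<lambda>n. active (xs (n + M)) (ys (n + M)) = active x y) sequentially"
    by (rule limit_of_minimizers(2)[OF x LIMSEQ_ignore_initial_segment[OF xs] xsX
          LIMSEQ_ignore_initial_segment[OF ylim] minM])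
  from eventually_happens[OF this] obtain n where "active (xs (n + M)) (ys (n + M)) = active x y"
    by auto
  then have "\<exists>y'. minimizer (xs (n + M)) y' \<and> active (xs (n + M)) y' = active x y \<and> dist y' y < \<epsilon>"
    using minM[of n] M[of "n + M"] \<rho>(2) by (intro exI[of _ "ys (n + M)"]) auto
  then show False using not[of "r (n + M) + N"] by (simp add: xs_def)
qed

text \<open>Sending each minimizer to a nearby one with the same active set is a bijection:
  separation at \<open>x\<close> makes it injective, and it is onto because every minimizer at
  \<open>x'\<close> is near one at \<open>x\<close> and separation holds at \<open>x'\<close>. Two
  distances below \<open>\<epsilon> / 2\<close> add up to less than the separation
  \<open>\<epsilon>\<close>.\<close>

lemma eventually_card_minimizers_eq:
  assumes x: "x \<in> X" and fin: "finite {y. minimizer x y}"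
  shows "eventually (\<lambda>x'. x' \<in> X \<longrightarrow>
    card {y \<in> stratum k h J x. minimizer x y} = card {y \<in> stratum k h J x'. minimizer x' y}) (nhds x)"
proof -
  define M where "M = (\<lambda>x. {y. minimizer x y \<and> active x y = J})"
  have M: "{y \<in> stratum k h J x. minimizer x y} = M x" for x
    by (auto simp: M_def stratum_def minimizer_feasible)
  obtain \<epsilon> where \<epsilon>: "\<epsilon> > 0" and sep: "eventually (\<lambda>x'. x' \<in> X \<longrightarrow>
    (\<forall>y z. minimizer x' y \<longrightarrow> minimizer x' z \<longrightarrow> dist y z < \<epsilon> \<longrightarrow> y = z)) (nhds x)"
    using eventually_minimizers_separated[OF x] by blast
  have sepx: "y = z" if "y \<in> M x" "z \<in> M x" "dist y z < \<epsilon>" for y z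
    using eventually_nhds_x_imp_x[OF sep] x that by (auto simp: M_def)
  have \<epsilon>2: "\<epsilon> / 2 > 0" using \<epsilon> by simp
  \<comment> \<open>Finiteness gives one neighbourhood of \<open>x\<close> on which all minimizers
    in the stratum persist.\<close>
  have "finite (M x)" by (rule finite_subset[OF _ fin]) (auto simp: M_def)
  moreover have "eventually (\<lambda>x'. x' \<in> X \<longrightarrow> (\<exists>y'\<in>M x'. dist y' y < \<epsilon> / 2)) (nhds x)" if "y \<in> M x" for y
    using eventually_minimizer_persists[OF x _ \<epsilon>2, of y] that
    by (auto simp: M_def elim!: eventually_mono)
  ultimately have "eventually (\<lambda>x'. \<forall>y\<in>M x. x' \<in> X \<longrightarrow> (\<exists>y'\<in>M x'. dist y' y < \<epsilon> / 2)) (nhds x)"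
    by (intro eventually_ball_finite) auto
  with sep eventually_minimizers_near[OF x \<epsilon>2]
  show ?thesis
  proof eventually_elim
    case (elim x')
    show ?case
    proof
      assume x': "x' \<in> X"
      from elim(3) x' have "\<forall>y\<in>M x. \<exists>y'. y' \<in> M x' \<and> dist y' y < \<epsilon> / 2" by blast
      from bchoice[OF this] obtain f where f: "\<And>y. y \<in> M x \<Longrightarrow> f y \<in> M x'"
        "\<And>y. y \<in> M x \<Longrightarrow> dist (f y) y < \<epsilon> / 2" by blast
      have "inj_on f (M x)"
      proof (rule inj_onI)
        fix y z assume "y \<in> M x" "z \<in> M x" "f y = f z"
        then show "y = z"
          using sepx[of y z] f(2)[of y] f(2)[of z] dist_triangle_half_r[of "f y" y \<epsilon> z] by simp
      qed
      moreover have "f ` M x = M x'"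
      proof (intro equalityI image_subsetI f(1) subsetI)
        fix y' assume y': "y' \<in> M x'"
        then obtain y where y: "y \<in> M x" "dist y' y < \<epsilon> / 2"
          using elim(2) x' by (force simp: M_def)
        have "dist (f y) y' < \<epsilon>"
          using f(2)[OF y(1)] y(2) by (rule dist_triangle_half_l)
        then have "f y = y'"
          using elim(1) x' f(1)[OF y(1)] y' by (auto simp: M_def)
        then show "y' \<in> f ` M x" using y(1) by blast
      qed
      ultimately have "card (M x') = card (M x)" by (metis card_image)
      then show "card {y \<in> stratum k h J x. minimizer x y} = card {y \<in> stratum k h J x'. minimizer x' y}"
        by (simp add: M)
    qed
  qed
qed

end

theorem theorem2p8:
  fixes X :: "(real^'n) set"
    and g :: "real^'n \<Rightarrow> real^'m \<Rightarrow> real"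
    and k :: nat
    and h :: "nat \<Rightarrow> real^'n \<Rightarrow> real^'m \<Rightarrow> real"
    and J :: "nat set"
    and x1 x2 :: "real^'n"
  assumes "MGB X" and "connected X"
    and "smooth_on (X \<times> UNIV) (\<lambda>(x, y). g x y)"
    and "\<And>i. i \<in> {1..k} \<Longrightarrow> smooth_on (X \<times> UNIV) (\<lambda>(x, y). h i x y)"
    and "\<And>x. x \<in> X \<Longrightarrow> feasible k h x \<noteq> {}"
    and "uniformly_bounded X (feasible k h)"
    and "\<And>x. x \<in> X \<Longrightarrow> LICQ k h x"
    and "\<And>x. x \<in> X \<Longrightarrow> SCSC g k h x"
    and "uniform_SOSC X g k h"
    and "\<And>x. x \<in> X \<Longrightarrow> finite {y. local_minimizer g k h x y}"
    and "J \<subseteq> {1..k}" and "x1 \<in> X" and "x2 \<in> X"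
  shows "card {y \<in> stratum k h J x1. local_minimizer g k h x1 y}
       = card {y \<in> stratum k h J x2. local_minimizer g k h x2 y}"
proof -
  have C2_h: "C2_family X (h i)" if "i \<in> {1..k}" for i
    by (rule smooth_on_imp_C2_family[OF assms(4)[OF that]])
  interpret parametric_program X g k h
    by (rule parametric_program.intro[OF smooth_on_imp_C2_family[OF assms(3)] C2_h assms(6-9)])
  show ?thesis
  proof (rule connected_local_const[OF assms(2,12,13)], rule ballI)
    fix x assume x: "x \<in> X"
    show "eventually (\<lambda>x'. card {y \<in> stratum k h J x. minimizer x y}
        = card {y \<in> stratum k h J x'. minimizer x' y}) (at x within X)"
      using eventually_card_minimizers_eq[OF x assms(10)[OF x], of J]
      unfolding eventually_at_filter by eventually_elim blast
  qed
qed

end
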